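(* Let $X$ be a Banach space, let $\{S(t)\}_{t\ge0}$ be a $\kappa$-times integrated semigroup on $X$ with generator $A$ ($\kappa\ge0$), and let $a\ge0$, $\omega\le a$ and $0\le\alpha\le\kappa$ be real numbers. Then the following assertions are equivalent: (1) $\displaystyle \sup_{t>0}\,t^{-\alpha}e^{-\omega t}\|S(t)\|<\infty$; (2) $\displaystyle \sup_{n\in\mathbb N\cup\{0\}}\ \sup_{\lambda>a}\left\|\frac{(\lambda-\omega)^{n+\alpha+1}}{\Gamma(n+\alpha+1)}\,\frac{d^n}{d\lambda^n}\left(\frac{R(\lambda,A)}{\lambda^\kappa}\right)\right\|<\infty$.
   Context: For $\kappa\ge0$, a (possibly multivalued) closed linear operator $A$ on $X$ with nonempty resolvent set $\rho(A)$ is the generator of a $\kappa$-times integrated semigroup $S$ if there exist $\omega_0\ge0$ and a strongly continuous function $S:[0,\infty)\to\mathcal L(X)$ having a Laplace transform for $\lambda>\omega_0$ such that $(\omega_0,\infty)\subset\rho(A)$ and $R(\lambda,A)=\lambda^\kappa\int_0^\infty e^{-\lambda t}S(t)\,dt$ for $\lambda>\omega_0$ (integrals understood strongly), where $R(\lambda,A)=(\lambda-A)^{-1}$. Because $A$ may be multivalued, $R(\lambda,A)$ is in general a pseudo-resolvent (a family of bounded operators satisfying the resolvent equation, not necessarily injective). Assertion (2) is understood to include that $(a,\infty)\subset\rho(A)$, so that the expression makes sense. *)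

theory Defs
  imports "HOL-Analysis.Analysis"
begin

text \<open>
  A multivalued linear operator on \<open>X\<close> is a linear relation \<open>A\<close>, i.e. a linear subspace of
  \<open>X \<times> X\<close>, where \<open>(x, y) \<in> A\<close> means \<open>y \<in> A x\<close>. Scalars are real; a complex Banach space
  and a complex-linear relation on it are covered by restricting the scalars, since only real
  points of the resolvent set are used.
\<close>

definition op_graph :: "('a::real_normed_vector \<Rightarrow>\<^sub>L 'a) \<Rightarrow> ('a \<times> 'a) set" where
  "op_graph R = {(u, blinfun_apply R u) | u. True}"

definition shifted_inverse :: "real \<Rightarrow> ('a::real_normed_vector \<times> 'a) set \<Rightarrow> ('a \<times> 'a) set" where
  "shifted_inverse l A = {(l *\<^sub>R x - y, x) | x y. (x, y) \<in> A}"

definition resolvent_set :: "('a::real_normed_vector \<times> 'a) set \<Rightarrow> real set" where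
  "resolvent_set A = {l. \<exists>R. shifted_inverse l A = op_graph R}"

text \<open>Meaningful only for \<open>l \<in> resolvent_set A\<close>; a bounded operator is determined by its graph.\<close>

definition resolvent :: "real \<Rightarrow> ('a::real_normed_vector \<times> 'a) set \<Rightarrow> ('a \<Rightarrow>\<^sub>L 'a)" where
  "resolvent l A = (THE R. shifted_inverse l A = op_graph R)"

text \<open>
  The Laplace integral is an improper integral, convergent in the strong sense. It need not converge
  absolutely. If it converges at every \<open>x\<close>, the limit operator is bounded by the uniform boundedness
  principle, so asking for \<open>L\<close> to be bounded is no restriction.
\<close>

definition has_laplace_transform ::
  "(real \<Rightarrow> 'a::banach \<Rightarrow>\<^sub>L 'a) \<Rightarrow> real \<Rightarrow> ('a \<Rightarrow>\<^sub>L 'a) \<Rightarrow> bool" where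
  "has_laplace_transform S l L \<longleftrightarrow>
     (\<forall>x. ((\<lambda>T. integral {0..T} (\<lambda>t. exp (- (l * t)) *\<^sub>R blinfun_apply (S t) x))
            \<longlongrightarrow> blinfun_apply L x) at_top)"

text \<open>
  \<open>A\<close> is the generator of the \<open>\<kappa>\<close>-times integrated semigroup \<open>S\<close>. Only the values of \<open>S\<close> on
  \<open>[0, \<infinity>)\<close> matter.
\<close>

definition integrated_semigroup_generator ::
  "real \<Rightarrow> (real \<Rightarrow> 'a::banach \<Rightarrow>\<^sub>L 'a) \<Rightarrow> ('a \<times> 'a) set \<Rightarrow> bool" where
  "integrated_semigroup_generator \<kappa> S A \<longleftrightarrow>
     subspace A \<and> closed A \<and> resolvent_set A \<noteq> {} \<and>
     (\<forall>x. continuous_on {0..} (\<lambda>t. blinfun_apply (S t) x)) \<and>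
     (\<exists>\<omega>\<^sub>0\<ge>0. {\<omega>\<^sub>0<..} \<subseteq> resolvent_set A \<and>
        (\<forall>l>\<omega>\<^sub>0. \<exists>L. has_laplace_transform S l L \<and> resolvent l A = (l powr \<kappa>) *\<^sub>R L))"

text \<open>
  Iterated derivative of a function of a real variable with values in a normed space (below:
  \<open>\<L>(X)\<close> with the operator norm). It is only used at interior points of a set on which
  the function is smooth, where \<open>vector_derivative\<close> is the genuine derivative.
\<close>

definition nth_vector_derivative ::
  "nat \<Rightarrow> (real \<Rightarrow> 'b::real_normed_vector) \<Rightarrow> real \<Rightarrow> 'b" where
  "nth_vector_derivative n f = ((\<lambda>g x. vector_derivative g (at x)) ^^ n) f"

end

(*
  (2) ==> (1): the Post-Widder inversion formula recovers S(t)x as the limit of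
  (-1)^n / n! (n/t)^(n+1) F^(n)(n/t) x, where F(l) = l^(-kappa) R(l) is the Laplace transform of S;
  the bounds on F^(n) and Gamma(n+alpha+1) ~ n! n^alpha give t^alpha e^(omega t) in the limit.
  As the Laplace integrals need not converge absolutely, the formula is applied at b + n/t to
  e^(-bt) S(t)x, whose primitive G is bounded: integration by parts turns the n-th term
  into an integral of G against a kernel that changes sign at t and approximates the derivative at t.

  (1) ==> (2): the Laplace integrals L(l) of S converge absolutely for l > a. For a fixed large c, the
  identity l^kappa L(l) - R(c) = (c - l) R(c) l^kappa L(l), divided by l^(kappa+1), equates
  Laplace transforms of functions on the half-line. It holds for large l, so by
  injectivity of the Laplace transform it holds for all l > a, and it identifies l^kappa L(l) with R(l).
  The bounds on the derivatives are then Gamma integrals.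
*)

theory Submission
  imports Defs "HOL-Real_Asymp.Real_Asymp"
begin

subsection \<open>Improper integrals\<close>

text \<open>The obstacle is that \<open>S\<close> is only strongly continuous. It may have no
  Laplace integral in operator norm, so transforms are taken orbit by orbit, whereas the derivatives
  in the theorem are operator-norm derivatives. Their existence therefore comes from the resolvent
  equation; after evaluation at a vector they are matched with moments of the orbit by uniqueness of
  successive derivatives. The division by \<open>l powr (\<kappa> + 1)\<close> makes every term the
  transform of a continuous function: \<open>(1 / l) *\<^sub>R L l x\<close> belongs to the
  primitive of the orbit, and \<open>1 / l powr (\<kappa> + 1)\<close> to
  \<open>t powr \<kappa> / Gamma (\<kappa> + 1)\<close>. Dividing by \<open>l powr \<kappa>\<close>
  only would produce a function unbounded at 0 for 0 < \<kappa> < 1 and a point mass for \<kappa> =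
  0. The kernel with changing sign is controlled through its product with \<open>s - t\<close>,
  which is nonnegative; all constants in the error estimate are then exact central moments of a
  Gamma distribution.\<close>

definition has_improper_integral :: "(real \<Rightarrow> 'b::real_normed_vector) \<Rightarrow> 'b \<Rightarrow> bool" where
  "has_improper_integral f I \<longleftrightarrow> ((\<lambda>T. integral {0..T} f) \<longlongrightarrow> I) at_top"

lemma has_improper_integral_unique:
  "has_improper_integral f I \<Longrightarrow> has_improper_integral f J \<Longrightarrow> I = J"
  unfolding has_improper_integral_def by (rule tendsto_unique) auto

lemma integral_cong_greater:
  fixes f g :: "real \<Rightarrow> 'b::real_normed_vector"
  assumes "\<And>t. t > 0 \<Longrightarrow> f t = g t"
  shows "integral {0..T} f = integral {0..T} g"
  by (rule integral_spike[of "{0}"]) (use assms in \<open>auto simp: less_le\<close>)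

lemma has_improper_integral_cong:
  assumes "\<And>t. t > 0 \<Longrightarrow> f t = g t"
  shows "has_improper_integral f I \<longleftrightarrow> has_improper_integral g I"
  unfolding has_improper_integral_def by (simp add: integral_cong_greater[of f g] assms)

lemma integrable_on_halfline:
  fixes f :: "real \<Rightarrow> 'b::banach"
  assumes "continuous_on {0..} f" "0 \<le> S"
  shows "f integrable_on {S..T}"
  by (rule integrable_continuous_interval) (rule continuous_on_subset[OF assms(1)], use assms(2) in auto)

lemma has_improper_integral_add:
  fixes f :: "real \<Rightarrow> 'b::banach"
  assumes "has_improper_integral f I" "has_improper_integral g J"
    "continuous_on {0..} f" "continuous_on {0..} g"
  shows "has_improper_integral (\<lambda>t. f t + g t) (I + J)"
proof -
  have "(\<lambda>T. integral {0..T} (\<lambda>t. f t + g t)) = (\<lambda>T. integral {0..T} f + integral {0..T} g)"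
    by (rule ext, rule integral_add) (auto intro!: integrable_on_halfline assms)
  then show ?thesis
    using assms(1,2) unfolding has_improper_integral_def by (auto intro: tendsto_add)
qed

lemma has_improper_integral_linear:
  fixes f :: "real \<Rightarrow> 'b::banach" and h :: "'b \<Rightarrow> 'c::banach"
  assumes "has_improper_integral f I" "continuous_on {0..} f" "bounded_linear h"
  shows "has_improper_integral (\<lambda>t. h (f t)) (h I)"
proof -
  have "(\<lambda>T. integral {0..T} (\<lambda>t. h (f t))) = (\<lambda>T. h (integral {0..T} f))"
    using integral_linear[OF integrable_on_halfline[OF assms(2) order_refl] assms(3)]
    by (auto simp: o_def)
  then show ?thesis
    using assms(1) bounded_linear.tendsto[OF assms(3)]
    unfolding has_improper_integral_def by auto
qed

lemma has_improper_integral_scaleR: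
  fixes f :: "real \<Rightarrow> 'b::banach"
  assumes "has_improper_integral f I"
  shows "has_improper_integral (\<lambda>t. c *\<^sub>R f t) (c *\<^sub>R I)"
  using assms unfolding has_improper_integral_def by (auto intro: tendsto_intros)

lemma has_improper_integral_diff:
  fixes f :: "real \<Rightarrow> 'b::banach"
  assumes "has_improper_integral f I" "has_improper_integral g J"
    "continuous_on {0..} f" "continuous_on {0..} g"
  shows "has_improper_integral (\<lambda>t. f t - g t) (I - J)"
  using has_improper_integral_add[OF assms(1) has_improper_integral_scaleR[OF assms(2), of "-1"]]
    assms(3,4) by (auto intro: continuous_intros)

text \<open>The majorants used later are \<open>t powr \<alpha>\<close> times an exponential. Since
  \<open>0 powr 0 = 0\<close>, they jump at 0 when \<alpha> = 0; hence a bound for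
  \<open>t > 0\<close> only, and integrability of \<open>g\<close> in place of continuity. The value
  at 0 is repaired on a null set.\<close>

lemma norm_improper_integral_le:
  fixes f :: "real \<Rightarrow> 'b::banach"
  assumes I: "has_improper_integral f I" and J: "has_improper_integral g J"
    and f: "continuous_on {0..} f" and g: "\<And>T. g integrable_on {0..T}"
    and le: "\<And>t. t > 0 \<Longrightarrow> norm (f t) \<le> g t"
  shows "norm I \<le> J"
proof -
  have "norm (integral {0..T} f) \<le> integral {0..T} g" for T
  proof -
    let ?g = "\<lambda>t. if t = 0 then norm (f 0) else g t"
    have "?g integrable_on {0..T}"
      by (rule integrable_spike[OF g, of "{0}"]) auto
    then have "norm (integral {0..T} f) \<le> integral {0..T} ?g"
      by (intro integral_norm_bound_integral integrable_on_halfline[OF f]) (use le in auto)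
    also have "\<dots> = integral {0..T} g"
      by (rule integral_cong_greater) auto
    finally show ?thesis .
  qed
  with I J show ?thesis
    unfolding has_improper_integral_def
    by (intro tendsto_le[OF _ J[unfolded has_improper_integral_def] tendsto_norm[OF I[unfolded has_improper_integral_def]]]) auto
qed

lemma improper_integral_exists:
  fixes f :: "real \<Rightarrow> 'b::banach"
  assumes J: "has_improper_integral g J"
    and f: "continuous_on {0..} f" and g: "continuous_on {0..} g"
    and le: "\<And>t. t > 0 \<Longrightarrow> norm (f t) \<le> g t"
  shows "\<exists>I. has_improper_integral f I"
proof -
  have sub: "norm (integral {0..T} f - integral {0..S} f) \<le> integral {0..T} g - integral {0..S} g"
    if "0 < S" "S \<le> T" for S T
  proof -
    have "norm (integral {S..T} f) \<le> integral {S..T} g"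
      by (intro integral_norm_bound_integral integrable_on_halfline[OF f] integrable_on_halfline[OF g])
        (use le that in auto)
    moreover have "integral {0..S} f + integral {S..T} f = integral {0..T} f"
      by (rule Henstock_Kurzweil_Integration.integral_combine) (use that integrable_on_halfline[OF f] in auto)
    moreover have "integral {0..S} g + integral {S..T} g = integral {0..T} g"
      by (rule Henstock_Kurzweil_Integration.integral_combine) (use that integrable_on_halfline[OF g] in auto)
    ultimately show ?thesis by (metis add_diff_cancel_left')
  qed
  have "\<exists>I. ((\<lambda>T. integral {0..T} f) \<longlongrightarrow> I) at_top"
  proof -
    have "cauchy_filter (filtermap (\<lambda>T. integral {0..T} f) at_top)"
      unfolding cauchy_filter_metric_filtermap
    proof (intro allI impI)
      fix e :: real assume e: "e > 0"
      have "eventually (\<lambda>T. dist (integral {0..T} g) J < e / 2) at_top"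
        using J e unfolding has_improper_integral_def tendsto_iff by (meson half_gt_zero)
      then obtain N where N: "\<And>T. T \<ge> N \<Longrightarrow> dist (integral {0..T} g) J < e / 2"
        by (auto simp: eventually_at_top_linorder)
      \<comment> \<open>The 1 keeps the interval between two such points away from 0, where
        \<open>le\<close> says nothing.\<close>
      let ?P = "\<lambda>T. T \<ge> max N 1"
      have main: "dist (integral {0..S} f) (integral {0..T} f) < e" if "?P S" "S \<le> T" for S T
      proof -
        have "dist (integral {0..S} f) (integral {0..T} f) \<le> integral {0..T} g - integral {0..S} g"
          using sub[of S T] that by (simp add: dist_norm norm_minus_commute)
        also have "\<dots> < e"
          using N[of S] N[of T] that by (simp add: dist_real_def abs_if split: if_splits)
        finally show ?thesis .
      qed
      have "dist (integral {0..S} f) (integral {0..T} f) < e" if "?P S" "?P T" for S T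
        using main[of S T] main[of T S] that by (cases "S \<le> T") (auto simp: dist_commute)
      moreover have "eventually ?P at_top"
        by (rule eventually_ge_at_top)
      ultimately show "\<exists>P. eventually P at_top \<and>
          (\<forall>x y. P x \<and> P y \<longrightarrow> dist (integral {0..x} f) (integral {0..y} f) < e)"
        by blast
    qed
    moreover have "complete (UNIV :: 'b set)"
      by (rule complete_UNIV)
    ultimately show ?thesis
      unfolding complete_uniform filterlim_def
      by (metis UNIV_I filtermap_bot_iff trivial_limit_at_top_linorder principal_eq_bot_iff top.extremum top_eq_principal_UNIV)
  qed
  then show ?thesis unfolding has_improper_integral_def .
qed

text \<open>Needed because the Gamma integral is given over the whole half-line. On
  \<open>cbox (-T) T\<close> with large \<open>T\<close>, cutting the function off at 0 leaves just
  the integral over \<open>{0..T}\<close>.\<close>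

lemma has_integral_imp_has_improper_integral:
  fixes f :: "real \<Rightarrow> 'b::banach"
  assumes "(f has_integral I) {0..}"
  shows "has_improper_integral f I"
  unfolding has_improper_integral_def tendsto_iff
proof (intro allI impI)
  fix e :: real assume "e > 0"
  then obtain B where B: "B > 0" "\<And>a b. ball 0 B \<subseteq> cbox a b \<Longrightarrow>
      \<exists>z. ((\<lambda>x. if x \<in> {0..} then f x else 0) has_integral z) (cbox a b) \<and> norm (z - I) < e"
    using assms unfolding has_integral_alt'[of f I] 
    by (metis (no_types, lifting) integrable_integral)
  have "dist (integral {0..T} f) I < e" if "T \<ge> B" for T
  proof -
    have "ball 0 B \<subseteq> cbox (-T) T"
      using that by (auto simp: dist_real_def)
    then obtain z where z: "((\<lambda>x. if x \<in> {0..} then f x else 0) has_integral z) (cbox (-T) T)"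
      "norm (z - I) < e"
      using B(2) by blast
    have "((\<lambda>x. if x \<in> {0..T} then f x else 0) has_integral z) (cbox (-T) T)"
      by (rule has_integral_eq[OF _ z(1)]) auto
    moreover have "{0..T} \<subseteq> cbox (-T) T" using that B by auto
    ultimately have "(f has_integral z) {0..T}"
      by (simp only: has_integral_restrict)
    then show ?thesis using z(2) by (auto simp: dist_norm dest: integral_unique)
  qed
  then show "eventually (\<lambda>T. dist (integral {0..T} f) I < e) at_top"
    using eventually_at_top_linorder by blast
qed

text \<open>The substitution \<open>m * s\<close> in the Gamma integral is made on each
  \<open>{0..T}\<close> before the limit. This also yields the second claim, which continuity cannot
  give for \<beta> = 0 because of the jump at 0.\<close>

lemma has_improper_integral_powr_exp:
  fixes m \<beta> :: real
  assumes "m > 0" "\<beta> \<ge> 0"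
  shows "has_improper_integral (\<lambda>s. s powr \<beta> * exp (- (m * s))) (Gamma (\<beta> + 1) / m powr (\<beta> + 1))"
    and "(\<lambda>s. s powr \<beta> * exp (- (m * s))) integrable_on {0..T}"
proof -
  let ?g = "\<lambda>t::real. t powr \<beta> / exp t"
  have g: "has_improper_integral ?g (Gamma (\<beta> + 1))"
    using has_integral_imp_has_improper_integral[OF Gamma_integral_real[of "\<beta> + 1"]] assms by simp
  have int: "?g integrable_on {0..T}" for T
    by (rule integrable_on_subinterval[of _ "{0..}"])
      (use Gamma_integral_real[of "\<beta> + 1"] assms in \<open>auto simp: integrable_on_def\<close>)
  have *: "((\<lambda>s. s powr \<beta> * exp (- (m * s))) has_integral
      (integral {0..m * T} ?g / m powr (\<beta> + 1))) {0..T}" for T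
  proof (cases "T \<ge> 0")
    case True
    have "((\<lambda>s. ?g (m * s)) has_integral (1 / m) *\<^sub>R integral {0..m * T} ?g) ((\<lambda>x. x / m) ` {0..m * T})"
      using has_integral_stretch_real[OF integrable_integral[OF int[of "m * T"]], of m] assms by simp
    moreover have "(\<lambda>x. x / m) ` {0..m * T} = {0..T}"
      using assms True by (force simp: field_simps image_iff intro!: bexI[of _ "m * _"])
    ultimately have "((\<lambda>s. ?g (m * s)) has_integral (1 / m) *\<^sub>R integral {0..m * T} ?g) {0..T}"
      by simp
    from has_integral_mult_right[OF this, of "m powr (- \<beta>)"] show ?thesis
      using assms
      by (elim has_integral_eq_rhs[OF has_integral_eq[rotated]])
        (auto simp: powr_mult powr_minus powr_add exp_minus field_simps)
  next
    case False
    then have "m * T < 0" using assms by (simp add: mult_pos_neg)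
    with False show ?thesis by (simp add: has_integral_empty)
  qed
  show "(\<lambda>s. s powr \<beta> * exp (- (m * s))) integrable_on {0..T}"
    using * by (auto simp: integrable_on_def)
  have "filterlim (\<lambda>T. m * T) at_top at_top"
    using assms by (intro filterlim_tendsto_pos_mult_at_top[OF tendsto_const]) (auto simp: filterlim_ident)
  then have "((\<lambda>T. integral {0..m * T} ?g) \<longlongrightarrow> Gamma (\<beta> + 1)) at_top"
    using g unfolding has_improper_integral_def by (rule filterlim_compose[rotated])
  then have "((\<lambda>T. integral {0..m * T} ?g / m powr (\<beta> + 1)) \<longlongrightarrow> Gamma (\<beta> + 1) / m powr (\<beta> + 1)) at_top"
    by (intro tendsto_intros) (use assms in auto)
  moreover have "(\<lambda>T. integral {0..T} (\<lambda>s. s powr \<beta> * exp (- (m * s)))) =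
      (\<lambda>T. integral {0..m * T} ?g / m powr (\<beta> + 1))"
    using * by (auto intro: integral_unique)
  ultimately show "has_improper_integral (\<lambda>s. s powr \<beta> * exp (- (m * s))) (Gamma (\<beta> + 1) / m powr (\<beta> + 1))"
    unfolding has_improper_integral_def by simp
qed

lemma has_improper_integral_power_exp:
  fixes m :: real
  assumes "m > 0"
  shows "has_improper_integral (\<lambda>s. s ^ k * exp (- (m * s))) (fact k / m ^ (k + 1))"
proof -
  have "Gamma (real k + 1) / m powr (real k + 1) = fact k / m ^ (k + 1)"
    using assms powr_realpow[of m "k + 1"] by (simp add: Gamma_fact add.commute)
  moreover have "has_improper_integral (\<lambda>s. s powr real k * exp (- (m * s)))
      (Gamma (real k + 1) / m powr (real k + 1))"
    using assms by (intro has_improper_integral_powr_exp) auto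
  ultimately show ?thesis
    by (subst has_improper_integral_cong[where g = "\<lambda>s. s powr real k * exp (- (m * s))"])
      (auto simp: powr_realpow)
qed

subsection \<open>Vector-valued Laplace transforms\<close>

definition has_laplace :: "(real \<Rightarrow> 'b::real_normed_vector) \<Rightarrow> real \<Rightarrow> 'b \<Rightarrow> bool" where
  "has_laplace f l I \<longleftrightarrow> has_improper_integral (\<lambda>t. exp (- (l * t)) *\<^sub>R f t) I"

lemma has_laplace_unique: "has_laplace f l I \<Longrightarrow> has_laplace f l J \<Longrightarrow> I = J"
  unfolding has_laplace_def by (rule has_improper_integral_unique)

lemma has_laplace_cong:
  "(\<And>t. t > 0 \<Longrightarrow> f t = g t) \<Longrightarrow> has_laplace f l I \<longleftrightarrow> has_laplace g l I"
  unfolding has_laplace_def by (rule has_improper_integral_cong) auto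

lemma has_laplace_add:
  fixes f :: "real \<Rightarrow> 'b::banach"
  assumes "has_laplace f l I" "has_laplace g l J" "continuous_on {0..} f" "continuous_on {0..} g"
  shows "has_laplace (\<lambda>t. f t + g t) l (I + J)"
  unfolding has_laplace_def scaleR_add_right
  by (intro has_improper_integral_add continuous_intros assms(3,4) assms(1,2)[unfolded has_laplace_def])

lemma has_laplace_diff:
  fixes f :: "real \<Rightarrow> 'b::banach"
  assumes "has_laplace f l I" "has_laplace g l J" "continuous_on {0..} f" "continuous_on {0..} g"
  shows "has_laplace (\<lambda>t. f t - g t) l (I - J)"
  unfolding has_laplace_def scaleR_diff_right
  by (intro has_improper_integral_diff continuous_intros assms(3,4) assms(1,2)[unfolded has_laplace_def])

lemma has_laplace_linear:
  fixes f :: "real \<Rightarrow> 'b::banach" and h :: "'b \<Rightarrow> 'c::banach"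
  assumes "has_laplace f l I" "continuous_on {0..} f" "bounded_linear h"
  shows "has_laplace (\<lambda>t. h (f t)) l (h I)"
proof -
  have "continuous_on {0..} (\<lambda>t. exp (- (l * t)) *\<^sub>R f t)"
    by (intro continuous_intros assms(2))
  from has_improper_integral_linear[OF assms(1)[unfolded has_laplace_def] this assms(3)]
  show ?thesis
    unfolding has_laplace_def linear_cmul[OF bounded_linear.linear[OF assms(3)]] .
qed

lemma has_laplace_scaleR:
  fixes f :: "real \<Rightarrow> 'b::banach"
  assumes "has_laplace f l I"
  shows "has_laplace (\<lambda>t. c *\<^sub>R f t) l (c *\<^sub>R I)"
  using has_improper_integral_scaleR[OF assms[unfolded has_laplace_def], of c]
  unfolding has_laplace_def by (simp add: mult.commute)

lemma continuous_on_primitive: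
  fixes f :: "real \<Rightarrow> 'b::banach"
  assumes "continuous_on {0..} f"
  shows "continuous_on {0..} (\<lambda>T. integral {0..T} f)"
proof -
  have "continuous_on {0..b} (\<lambda>T. integral {0..T} f)" for b
    by (intro indefinite_integral_continuous_1 integrable_on_halfline[OF assms]) auto
  have "isCont (\<lambda>T. integral {0..T} f) x" if "x > 0" for x
    by (rule continuous_on_interior[OF \<open>\<And>b. continuous_on {0..b} _\<close>[of "x + 1"]])
      (use that in auto)
  moreover have "continuous (at 0 within {0..}) (\<lambda>T. integral {0..T} f)"
  proof -
    have "continuous (at 0 within {0..1}) (\<lambda>T. integral {0..T} f)"
      using \<open>\<And>b. continuous_on {0..b} _\<close>[of 1] by (auto simp: continuous_on_eq_continuous_within)
    moreover have "at 0 within {0..1} = at (0::real) within {0..}"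
      by (rule at_within_nhd[of _ "{-1<..<1}"]) auto
    ultimately show ?thesis by simp
  qed
  ultimately show ?thesis
    unfolding continuous_on_eq_continuous_within
  proof (intro ballI)
    fix x :: real assume "x \<in> {0..}"
    then consider "x = 0" | "x > 0" by force
    then show "continuous (at x within {0..}) (\<lambda>T. integral {0..T} f)"
      using \<open>continuous (at 0 within {0..}) _\<close> \<open>\<And>x. x > 0 \<Longrightarrow> isCont _ x\<close>
      by cases (auto intro: continuous_at_imp_continuous_at_within)
  qed
qed

lemma primitive_has_vector_derivative:
  fixes f :: "real \<Rightarrow> 'b::banach"
  assumes "continuous_on {0..} f" "0 < t"
  shows "((\<lambda>T. integral {0..T} f) has_vector_derivative f t) (at t)"
proof -
  have "((\<lambda>T. integral {0..T} f) has_vector_derivative f t) (at t within {0..t + 1})"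
    by (rule integral_has_vector_derivative)
      (use assms in \<open>auto intro: continuous_on_subset\<close>)
  moreover have "at t within {0..t + 1} = at t"
    by (rule at_within_interior) (use assms in auto)
  ultimately show ?thesis by simp
qed

lemma integral_exp_by_parts:
  fixes f :: "real \<Rightarrow> 'b::banach"
  assumes f: "continuous_on {0..} f" and "0 \<le> T"
  shows "integral {0..T} (\<lambda>t. exp (- (l * t)) *\<^sub>R f t) =
    exp (- (l * T)) *\<^sub>R integral {0..T} f
      + l *\<^sub>R integral {0..T} (\<lambda>t. exp (- (l * t)) *\<^sub>R integral {0..t} f)"
proof -
  let ?V = "\<lambda>t. integral {0..t} f"
  have V: "continuous_on {0..} ?V"
    by (rule continuous_on_primitive[OF f])
  have int: "(\<lambda>t. exp (- (l * t)) *\<^sub>R f t) integrable_on {0..T}"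
    "(\<lambda>t. l *\<^sub>R exp (- (l * t)) *\<^sub>R ?V t) integrable_on {0..T}"
    by (intro integrable_on_halfline continuous_intros f V order_refl)+
  have "((\<lambda>t. exp (- (l * t)) *\<^sub>R f t - l *\<^sub>R exp (- (l * t)) *\<^sub>R ?V t) has_integral
      exp (- (l * T)) *\<^sub>R ?V T - exp (- (l * 0)) *\<^sub>R ?V 0) {0..T}"
  proof (rule fundamental_theorem_of_calculus_interior[OF \<open>0 \<le> T\<close>])
    show "continuous_on {0..T} (\<lambda>t. exp (- (l * t)) *\<^sub>R ?V t)"
      by (intro continuous_intros continuous_on_subset[OF V]) auto
    show "((\<lambda>t. exp (- (l * t)) *\<^sub>R ?V t) has_vector_derivative
        exp (- (l * x)) *\<^sub>R f x - l *\<^sub>R exp (- (l * x)) *\<^sub>R ?V x) (at x)" if "x \<in> {0<..<T}" for x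
    proof -
      have "((\<lambda>t. exp (- (l * t))) has_field_derivative - (l * exp (- (l * x)))) (at x)"
        by (auto intro!: derivative_eq_intros)
      from has_vector_derivative_scaleR[OF this primitive_has_vector_derivative[OF f]] that
      show ?thesis by simp
    qed
  qed
  then have "integral {0..T} (\<lambda>t. exp (- (l * t)) *\<^sub>R f t - l *\<^sub>R exp (- (l * t)) *\<^sub>R ?V t) =
      exp (- (l * T)) *\<^sub>R ?V T"
    by (auto dest: integral_unique)
  then show ?thesis
    unfolding Henstock_Kurzweil_Integration.integral_diff[OF int] by (simp only: integral_cmul diff_eq_eq)
qed

text \<open>\<open>lim\<close> is the boundary term of the integration by parts. It vanishes for two
  different reasons later: in the inversion formula the primitive is bounded, and under a growth
  bound it grows more slowly than \<open>exp (l * T)\<close>.\<close>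

lemma has_laplace_primitive:
  fixes f :: "real \<Rightarrow> 'b::banach"
  assumes f: "continuous_on {0..} f" and F: "has_laplace f l F" and l: "l \<noteq> 0"
    and lim: "((\<lambda>T. exp (- (l * T)) *\<^sub>R integral {0..T} f) \<longlongrightarrow> 0) at_top"
  shows "has_laplace (\<lambda>t. integral {0..t} f) l ((1 / l) *\<^sub>R F)"
proof -
  have "((\<lambda>T. (1 / l) *\<^sub>R (integral {0..T} (\<lambda>t. exp (- (l * t)) *\<^sub>R f t)
      - exp (- (l * T)) *\<^sub>R integral {0..T} f)) \<longlongrightarrow> (1 / l) *\<^sub>R (F - 0)) at_top"
    using F lim unfolding has_laplace_def has_improper_integral_def by (intro tendsto_intros)
  then show ?thesis
    unfolding has_laplace_def has_improper_integral_def diff_zero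
  proof (rule Lim_transform_eventually)
    show "eventually (\<lambda>T. (1 / l) *\<^sub>R (integral {0..T} (\<lambda>t. exp (- (l * t)) *\<^sub>R f t)
      - exp (- (l * T)) *\<^sub>R integral {0..T} f) =
      integral {0..T} (\<lambda>t. exp (- (l * t)) *\<^sub>R integral {0..t} f)) at_top"
    proof (rule eventually_mono[OF eventually_ge_at_top[of 0]])
      fix T :: real assume "0 \<le> T"
      show "(1 / l) *\<^sub>R (integral {0..T} (\<lambda>t. exp (- (l * t)) *\<^sub>R f t)
        - exp (- (l * T)) *\<^sub>R integral {0..T} f) =
        integral {0..T} (\<lambda>t. exp (- (l * t)) *\<^sub>R integral {0..t} f)"
        unfolding integral_exp_by_parts[OF f \<open>0 \<le> T\<close>] add_diff_cancel_left' using l by simp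
    qed
  qed
qed

section \<open>Exponentially bounded functions and derivatives of their Laplace transforms\<close>

definition exp_bounded :: "(real \<Rightarrow> 'b::real_normed_vector) \<Rightarrow> real \<Rightarrow> bool" where
  "exp_bounded f w \<longleftrightarrow> continuous_on {0..} f \<and> (\<forall>b>w. \<exists>C. \<forall>t\<ge>0. norm (f t) \<le> C * exp (b * t))"

lemma exp_bounded_has_laplace:
  fixes f :: "real \<Rightarrow> 'b::banach"
  assumes "exp_bounded f w" "l > w"
  shows "\<exists>I. has_laplace f l I"
proof -
  define b where "b = (w + l) / 2"
  have b: "b > w" "b < l" using assms(2) by (auto simp: b_def)
  with assms obtain C where C: "\<And>t. t \<ge> 0 \<Longrightarrow> norm (f t) \<le> C * exp (b * t)"
    unfolding exp_bounded_def by blast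
  show ?thesis
    unfolding has_laplace_def
  proof (rule improper_integral_exists)
    show "has_improper_integral (\<lambda>t. C *\<^sub>R (t ^ 0 * exp (- ((l - b) * t))))
        (C *\<^sub>R (fact 0 / (l - b) ^ (0 + 1)))"
      using b by (intro has_improper_integral_scaleR has_improper_integral_power_exp) auto
    show "continuous_on {0..} (\<lambda>t. exp (- (l * t)) *\<^sub>R f t)"
      using assms(1) by (auto simp: exp_bounded_def intro!: continuous_intros)
    show "norm (exp (- (l * t)) *\<^sub>R f t) \<le> C *\<^sub>R (t ^ 0 * exp (- ((l - b) * t)))" if "t > 0" for t
    proof -
      have "norm (exp (- (l * t)) *\<^sub>R f t) \<le> exp (- (l * t)) * (C * exp (b * t))"
        using C[of t] that by simp
      also have "\<dots> = C *\<^sub>R (t ^ 0 * exp (- ((l - b) * t)))"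
        by (simp add: algebra_simps flip: exp_add)
      finally show ?thesis .
    qed
  qed (auto intro!: continuous_intros)
qed

text \<open>\<open>exp_bounded\<close> asks for a bound at every \<open>b > w\<close>, not at
  \<open>w\<close>, precisely for this stability: half of the gap between \<open>w\<close> and
  \<open>b\<close> absorbs the factor \<open>t\<close>, so all moments keep the same
  \<open>w\<close>.\<close>

lemma exp_bounded_times_neg_id:
  fixes f :: "real \<Rightarrow> 'b::real_normed_vector"
  assumes "exp_bounded f w"
  shows "exp_bounded (\<lambda>t. - t *\<^sub>R f t) w"
  unfolding exp_bounded_def
proof (intro conjI allI impI)
  show "continuous_on {0..} (\<lambda>t. - t *\<^sub>R f t)"
    using assms by (auto simp: exp_bounded_def intro!: continuous_intros)
  fix b assume "b > w"
  define d where "d = (b - w) / 2"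
  have d: "d > 0" "b - d > w" using \<open>b > w\<close> by (auto simp: d_def field_simps)
  obtain C where C: "\<And>t. t \<ge> 0 \<Longrightarrow> norm (f t) \<le> C * exp ((b - d) * t)"
    using assms d unfolding exp_bounded_def by blast
  have "norm (- t *\<^sub>R f t) \<le> C / d * exp (b * t)" if "t \<ge> 0" for t
  proof -
    have "t \<le> exp (d * t) / d"
    proof -
      have "d * t \<le> exp (d * t)" using exp_ge_add_one_self[of "d * t"] by linarith
      then show ?thesis using d by (simp add: field_simps)
    qed
    then have "t * norm (f t) \<le> exp (d * t) / d * (C * exp ((b - d) * t))"
      using C[OF that] that d by (intro mult_mono) auto
    also have "\<dots> = C / d * exp (b * t)"
      by (simp add: algebra_simps flip: exp_add)
    finally show ?thesis using that by simp
  qed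
  then show "\<exists>C. \<forall>t\<ge>0. norm (- t *\<^sub>R f t) \<le> C * exp (b * t)" by blast
qed

text \<open>Everything follows from \<open>1 + x \<le> exp x\<close>, used at \<open>x\<close> and
  at \<open>- x\<close>. The factor \<open>exp \<bar>x\<bar>\<close> is affordable in a Laplace
  integral, where \<open>x\<close> is a small multiple of \<open>t\<close>.\<close>

lemma exp_remainder_bound:
  fixes x :: real
  shows "\<bar>exp x - 1 - x\<bar> \<le> x\<^sup>2 * exp \<bar>x\<bar>"
proof -
  have 1: "exp x - 1 \<le> x * exp x"
    using mult_left_mono[OF exp_ge_add_one_self[of "- x"], of "exp x"]
    by (simp add: algebra_simps flip: exp_add)
  have "exp x - 1 - x \<le> x * (exp x - 1)"
    using 1 by (simp add: algebra_simps)
  also have "\<dots> \<le> x\<^sup>2 * exp \<bar>x\<bar>"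
  proof (cases "x \<ge> 0")
    case True
    then show ?thesis
      using mult_left_mono[OF 1 True] by (simp add: power2_eq_square mult.assoc)
  next
    case False
    moreover have "x \<le> exp x - 1" using exp_ge_add_one_self[of x] by linarith
    ultimately have "x * (exp x - 1) \<le> x * x" by (intro mult_left_mono_neg) auto
    also have "\<dots> \<le> x * x * exp \<bar>x\<bar>"
      by (simp add: mult_le_cancel_left1)
    finally show ?thesis by (simp add: power2_eq_square)
  qed
  finally show ?thesis
    using exp_ge_add_one_self[of x] by linarith
qed

text \<open>Both direct differentiations, of a Laplace transform and of a resolvent, come with an
  explicit quadratic remainder.\<close>

lemma has_vector_derivativeI_quadratic:
  fixes f :: "real \<Rightarrow> 'b::real_normed_vector"
  assumes "d > 0" and le: "\<And>h. \<bar>h\<bar> < d \<Longrightarrow> norm (f (x + h) - f x - h *\<^sub>R D) \<le> K * h\<^sup>2"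
  shows "(f has_vector_derivative D) (at x)"
  unfolding has_vector_derivative_def has_derivative_at
proof (intro conjI bounded_linear_scaleR_left)
  have "eventually (\<lambda>h. h \<noteq> 0 \<and> \<bar>h\<bar> < d) (at (0::real))"
    using \<open>d > 0\<close> by (auto simp: eventually_at dist_real_def)
  then have "eventually (\<lambda>h. norm (f (x + h) - f x - h *\<^sub>R D) / norm h \<le> K * \<bar>h\<bar>) (at 0)"
  proof (rule eventually_mono)
    fix h assume h: "h \<noteq> 0 \<and> \<bar>h\<bar> < d"
    then have "norm (f (x + h) - f x - h *\<^sub>R D) \<le> K * \<bar>h\<bar> * \<bar>h\<bar>"
      using le[of h] by (simp add: power2_eq_square)
    then show "norm (f (x + h) - f x - h *\<^sub>R D) / norm h \<le> K * \<bar>h\<bar>"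
      using h by (simp add: divide_le_eq)
  qed
  moreover have "((\<lambda>h. K * \<bar>h\<bar>) \<longlongrightarrow> 0) (at (0::real))"
    by (auto intro!: tendsto_eq_intros)
  ultimately show "((\<lambda>h. norm (f (x + h) - f x - h *\<^sub>R D) / norm h) \<longlongrightarrow> 0) (at 0)"
    by (rule tendsto_sandwich[OF _ _ tendsto_const, rotated 1]) auto
qed

lemma laplace_has_vector_derivative:
  fixes f :: "real \<Rightarrow> 'b::banach"
  assumes f: "exp_bounded f w"
    and F: "\<And>l. l > w \<Longrightarrow> has_laplace f l (F l)"
    and F': "has_laplace (\<lambda>t. - t *\<^sub>R f t) l F'" and l: "l > w"
  shows "(F has_vector_derivative F') (at l)"
proof -
  define b where "b = (w + l) / 2"
  \<comment> \<open>Half of the gap between \<open>b\<close> and \<open>l\<close> is spent on the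
    perturbation \<open>\<bar>h\<bar> < d\<close>; the other half leaves the decay
    \<open>exp (- (d * t))\<close>.\<close>
  define d where "d = (l - b) / 2"
  have b: "b > w" and d: "d > 0" "l - d - b = d" using l by (auto simp: b_def d_def field_simps)
  have cf: "continuous_on {0..} f" using f by (simp add: exp_bounded_def)
  obtain C where C: "\<And>t. t \<ge> 0 \<Longrightarrow> norm (f t) \<le> C * exp (b * t)"
    using f b unfolding exp_bounded_def by blast
  show ?thesis
  \<comment> \<open>\<open>2 / d ^ 3\<close> is the integral of
    \<open>t ^ 2 * exp (- (d * t))\<close> over the half-line.\<close>
  proof (rule has_vector_derivativeI_quadratic[OF d(1), where K = "C * (2 / d ^ 3)"])
    fix h assume h: "\<bar>h\<bar> < d"
    let ?e = "\<lambda>t. exp (- ((l + h) * t)) *\<^sub>R f t - exp (- (l * t)) *\<^sub>R f t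
      - h *\<^sub>R (exp (- (l * t)) *\<^sub>R - t *\<^sub>R f t)"
    have "w < l + h" using h l d b by (auto simp: d_def b_def abs_if field_simps split: if_splits)
    then have e: "has_improper_integral ?e (F (l + h) - F l - h *\<^sub>R F')"
      using F[of "l + h"] F[OF l] F' unfolding has_laplace_def
      by (intro has_improper_integral_diff has_improper_integral_scaleR continuous_intros cf) auto
    have g: "has_improper_integral (\<lambda>t. (C * h\<^sup>2) *\<^sub>R (t ^ 2 * exp (- (d * t))))
        ((C * h\<^sup>2) *\<^sub>R (fact 2 / d ^ (2 + 1)))"
      using d by (intro has_improper_integral_scaleR has_improper_integral_power_exp) auto
    have "norm (F (l + h) - F l - h *\<^sub>R F') \<le> (C * h\<^sup>2) *\<^sub>R (fact 2 / d ^ (2 + 1))"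
    proof (rule norm_improper_integral_le[OF e g])
      show "continuous_on {0..} ?e"
        by (intro continuous_intros cf)
      show "(\<lambda>t. (C * h\<^sup>2) *\<^sub>R (t ^ 2 * exp (- (d * t)))) integrable_on {0..T}" for T
        by (intro integrable_on_halfline[OF _ order_refl] continuous_intros)
      show "norm (?e t) \<le> (C * h\<^sup>2) *\<^sub>R (t ^ 2 * exp (- (d * t)))" if t: "t > 0" for t
      proof -
        have C0: "C \<ge> 0" using C[of 0] by (simp add: order_trans[OF norm_ge_zero])
        have "?e t = (exp (- (l * t)) * (exp (- (h * t)) - 1 - - (h * t))) *\<^sub>R f t"
        proof -
          have "exp (- ((l + h) * t)) = exp (- (l * t)) * exp (- (h * t))"
            by (simp add: algebra_simps flip: exp_add)
          then show ?thesis by (simp add: algebra_simps)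
        qed
        then have "norm (?e t) = exp (- (l * t)) * \<bar>exp (- (h * t)) - 1 - - (h * t)\<bar> * norm (f t)"
          by (simp add: abs_mult)
        also have "\<dots> \<le> exp (- (l * t)) * ((- (h * t))\<^sup>2 * exp \<bar>- (h * t)\<bar>) * (C * exp (b * t))"
          using exp_remainder_bound[of "- (h * t)"] C[of t] t by (intro mult_mono) auto
        also have "\<dots> = C * h\<^sup>2 * t\<^sup>2 * (exp (- (l * t)) * exp (\<bar>h\<bar> * t) * exp (b * t))"
          using t by (simp add: abs_mult power_mult_distrib)
        also have "\<dots> = C * h\<^sup>2 * t\<^sup>2 * exp (- ((l - \<bar>h\<bar> - b) * t))"
          by (simp add: algebra_simps flip: exp_add)
        also have "\<dots> \<le> C * h\<^sup>2 * t\<^sup>2 * exp (- (d * t))"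
        proof -
          have "d \<le> l - \<bar>h\<bar> - b" using d h by linarith
          then have "d * t \<le> (l - \<bar>h\<bar> - b) * t" using t by (intro mult_right_mono) auto
          then show ?thesis using C0 by (intro mult_left_mono) auto
        qed
        finally show ?thesis by simp
      qed
    qed
    then show "norm (F (l + h) - F l - h *\<^sub>R F') \<le> C * (2 / d ^ 3) * h\<^sup>2"
      by (simp add: field_simps eval_nat_numeral)
  qed
qed

definition laplace :: "(real \<Rightarrow> 'b::real_normed_vector) \<Rightarrow> real \<Rightarrow> 'b" where
  "laplace f l = (THE I. has_laplace f l I)"

lemma laplace_eqI: "has_laplace f l I \<Longrightarrow> laplace f l = I"
  unfolding laplace_def by (rule the_equality) (auto dest: has_laplace_unique)

lemma has_laplace_laplace:
  fixes f :: "real \<Rightarrow> 'b::banach"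
  shows "exp_bounded f w \<Longrightarrow> l > w \<Longrightarrow> has_laplace f l (laplace f l)"
  using exp_bounded_has_laplace[of f w l] laplace_eqI[of f l] by auto

lemma exp_bounded_moment:
  fixes f :: "real \<Rightarrow> 'b::real_normed_vector"
  assumes "exp_bounded f w"
  shows "exp_bounded (\<lambda>t. (- t) ^ n *\<^sub>R f t) w"
proof (induction n)
  case (Suc n)
  from exp_bounded_times_neg_id[OF this] show ?case by simp
qed (use assms in simp)

lemma laplace_moment_has_vector_derivative:
  fixes f :: "real \<Rightarrow> 'b::banach"
  assumes "exp_bounded f w" "l > w"
  shows "((\<lambda>l. laplace (\<lambda>t. (- t) ^ n *\<^sub>R f t) l) has_vector_derivative
    laplace (\<lambda>t. (- t) ^ Suc n *\<^sub>R f t) l) (at l)"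
proof (rule laplace_has_vector_derivative[OF exp_bounded_moment[OF assms(1), of n]])
  show "has_laplace (\<lambda>t. (- t) ^ n *\<^sub>R f t) m (laplace (\<lambda>t. (- t) ^ n *\<^sub>R f t) m)" if "m > w" for m
    by (rule has_laplace_laplace[OF exp_bounded_moment[OF assms(1)] that])
  have "(\<lambda>t. - t *\<^sub>R (- t) ^ n *\<^sub>R f t) = (\<lambda>t. (- t) ^ Suc n *\<^sub>R f t)"
    by simp
  then show "has_laplace (\<lambda>t. - t *\<^sub>R (- t) ^ n *\<^sub>R f t) l (laplace (\<lambda>t. (- t) ^ Suc n *\<^sub>R f t) l)"
    using has_laplace_laplace[OF exp_bounded_moment[OF assms(1), of "Suc n"] assms(2)] by (simp only:)
qed (rule assms(2))

text \<open>Agreement on an open half-line passes from each order to the next. Derivatives known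
  only as an abstract chain are thereby given a concrete formula once their order-0 terms agree, and
  no conditionally convergent integral has to be differentiated.\<close>

lemma derivative_chain_unique:
  fixes D E :: "nat \<Rightarrow> real \<Rightarrow> 'b::real_normed_vector"
  assumes "\<And>n l. l > w \<Longrightarrow> (D n has_vector_derivative D (Suc n) l) (at l)"
    and "\<And>n l. l > w \<Longrightarrow> (E n has_vector_derivative E (Suc n) l) (at l)"
    and "\<And>l. l > w \<Longrightarrow> D 0 l = E 0 l"
  shows "l > w \<Longrightarrow> D n l = E n l"
proof (induction n arbitrary: l)
  case (Suc n)
  have "(E n has_vector_derivative D (Suc n) l) (at l)"
    by (rule has_vector_derivative_transform_within_open[OF assms(1)[OF Suc.prems], of "{w<..}"])
      (use Suc in auto)
  then show ?case
    using vector_derivative_unique_at assms(2)[OF Suc.prems] by blast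
qed (use assms in auto)

subsection \<open>The Post-Widder inversion formula\<close>

lemma has_improper_integral_poly_exp:
  fixes m :: real
  assumes "m > 0"
  shows "has_improper_integral (\<lambda>s. (\<Sum>k<N. p k * s ^ k) * s ^ j * exp (- (m * s)))
    (\<Sum>k<N. p k * (fact (j + k) / m ^ (j + k + 1)))"
proof (induction N)
  case 0
  then show ?case by (simp add: has_improper_integral_def)
next
  case (Suc N)
  have "has_improper_integral (\<lambda>s. p N *\<^sub>R (s ^ (j + N) * exp (- (m * s))))
      (p N *\<^sub>R (fact (j + N) / m ^ (j + N + 1)))"
    by (intro has_improper_integral_scaleR has_improper_integral_power_exp assms)
  from Suc this have "has_improper_integral (\<lambda>s. (\<Sum>k<N. p k * s ^ k) * s ^ j * exp (- (m * s)) +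
      p N *\<^sub>R (s ^ (j + N) * exp (- (m * s))))
      ((\<Sum>k<N. p k * (fact (j + k) / m ^ (j + k + 1))) + p N *\<^sub>R (fact (j + N) / m ^ (j + N + 1)))"
    by (rule has_improper_integral_add) (intro continuous_intros)+
  then show ?case
    by (simp add: algebra_simps power_add)
qed

text \<open>
  For \<open>n = j + 1\<close>, this is \<open>(-1)\<^sup>n m\<^sup>n\<^sup>+\<^sup>1 / n!\<close> times the \<open>n\<close>-th derivative of
  \<open>m \<mapsto> m exp (- m s)\<close>, at \<open>m = n / t\<close>.
\<close>

definition pw_kernel :: "nat \<Rightarrow> real \<Rightarrow> real \<Rightarrow> real" where
  "pw_kernel j t s = (Suc j / t) ^ (j + 3) / fact (Suc j) * ((s - t) * s ^ j * exp (- (Suc j / t * s)))"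

lemma continuous_on_pw_kernel: "continuous_on A (pw_kernel j t)"
  unfolding pw_kernel_def by (intro continuous_intros)

lemma fact_rising:
  "fact (j + 1) = (real j + 1) * fact j"
  "fact (j + 2) = (real j + 2) * (real j + 1) * fact j"
  "fact (j + 3) = (real j + 3) * (real j + 2) * (real j + 1) * fact j"
  "fact (j + 4) = (real j + 4) * (real j + 3) * (real j + 2) * (real j + 1) * fact j"
  by (simp_all add: eval_nat_numeral algebra_simps)

text \<open>Up to normalisation, \<open>s ^ j * exp (- (m * s))\<close> with
  \<open>m = Suc j / t\<close> is the density of the Gamma distribution with shape
  \<open>Suc j\<close>, rate \<open>m\<close> and mean \<open>t\<close>. The kernel carries one more
  factor \<open>s - t\<close>, so these are its central moments of order 1, 2 and 4, scaled to make
  the second one 1. The first two say that the kernel imitates the derivative at \<open>t\<close>;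
  the last is the error term, of order \<open>1 / j\<close>.\<close>

lemma pw_kernel_moments:
  assumes "t > 0"
  shows "has_improper_integral (pw_kernel j t) 0"
    and "has_improper_integral (\<lambda>s. pw_kernel j t s * (s - t)) 1"
    and "has_improper_integral (\<lambda>s. pw_kernel j t s * (s - t) ^ 3)
      ((3 * real (Suc j) + 6) * t\<^sup>2 / (real (Suc j))\<^sup>2)"
proof -
  define m where "m = Suc j / t"
  define c where "c = m ^ (j + 3) / fact (Suc j)"
  define q where "q = real j + 1"
  have q: "q > 0" by (simp add: q_def)
  have m: "m > 0" "t = q / m" using assms by (auto simp: m_def q_def field_simps)
  have k: "pw_kernel j t s = c * ((s - t) * s ^ j * exp (- (m * s)))" for s
    by (simp add: pw_kernel_def m_def c_def)
  \<comment> \<open>\<open>p\<close> lists the coefficients of \<open>(s - t) * r s\<close> as a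
    polynomial in \<open>s\<close>; in the three uses this is the binomial expansion of
    \<open>s - t\<close> to the power 1, 2 and 4.\<close>
  have *: "has_improper_integral (\<lambda>s. pw_kernel j t s * r s) (c * I)"
    if "\<And>s. (\<Sum>k<N. p k * s ^ k) = (s - t) * r s"
      "(\<Sum>k<N. p k * (fact (j + k) / m ^ (j + k + 1))) = I" for p N r I
    using has_improper_integral_scaleR[OF has_improper_integral_poly_exp[OF m(1), of p N j], of c]
    unfolding that k by (simp add: mult_ac)
  have f: "fact (Suc j) = q * fact j" by (simp add: q_def algebra_simps)
  have "has_improper_integral (\<lambda>s. pw_kernel j t s * 1) (c * 0)"
  proof (rule *[where N = 2 and p = "\<lambda>k. if k = 0 then - t else 1"])
    have "(\<Sum>k<2. (if k = 0 then - t else 1) * (fact (j + k) / m ^ (j + k + 1)))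
        = - t * (fact j / m ^ (j + 1)) + fact (j + 1) / m ^ (j + 2)"
      by (simp add: eval_nat_numeral)
    also have "\<dots> = 0"
      unfolding fact_rising m(2) using m(1) by (simp add: field_simps q_def)
    finally show "(\<Sum>k<2. (if k = 0 then - t else 1) * (fact (j + k) / m ^ (j + k + 1))) = 0" .
  qed (simp add: eval_nat_numeral)
  then show "has_improper_integral (pw_kernel j t) 0" by simp
  have "has_improper_integral (\<lambda>s. pw_kernel j t s * (s - t)) (c * (q * fact j / m ^ (j + 3)))"
  proof (rule *[where N = 3 and p = "\<lambda>k. if k = 0 then t\<^sup>2 else if k = 1 then - 2 * t else 1"])
    show "(\<Sum>k<3. (if k = 0 then t\<^sup>2 else if k = 1 then - 2 * t else 1) * (fact (j + k) / m ^ (j + k + 1)))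
        = q * fact j / m ^ (j + 3)"
    proof -
      have "(\<Sum>k<3. (if k = 0 then t\<^sup>2 else if k = 1 then - 2 * t else 1) * (fact (j + k) / m ^ (j + k + 1)))
        = t\<^sup>2 * (fact j / m ^ (j + 1)) + - 2 * t * (fact (j + 1) / m ^ (j + 2)) + fact (j + 2) / m ^ (j + 3)"
        by (simp add: eval_nat_numeral)
      also have "\<dots> = q * fact j / m ^ (j + 3)"
        unfolding fact_rising m(2) using m(1)
        by (simp add: field_simps power_add power2_eq_square power3_eq_cube q_def)
      finally show ?thesis .
    qed
  qed (simp add: eval_nat_numeral algebra_simps)
  then show "has_improper_integral (\<lambda>s. pw_kernel j t s * (s - t)) 1"
  proof -
    have "c * (q * fact j / m ^ (j + 3)) = 1"
      unfolding c_def f using m(1) q by simp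
    then show "has_improper_integral (\<lambda>s. pw_kernel j t s * (s - t)) (c * (q * fact j / m ^ (j + 3))) \<Longrightarrow>
        has_improper_integral (\<lambda>s. pw_kernel j t s * (s - t)) 1" by (simp only:)
  qed
  have "has_improper_integral (\<lambda>s. pw_kernel j t s * (s - t) ^ 3) (c * ((3 * q + 6) * q * fact j / m ^ (j + 5)))"
  proof (rule *[where N = 5 and p = "\<lambda>k. if k = 0 then t ^ 4 else if k = 1 then - 4 * t ^ 3 else
        if k = 2 then 6 * t\<^sup>2 else if k = 3 then - 4 * t else 1"])
    show "(\<Sum>k<5. (if k = 0 then t ^ 4 else if k = 1 then - 4 * t ^ 3 else
        if k = 2 then 6 * t\<^sup>2 else if k = 3 then - 4 * t else 1) * (fact (j + k) / m ^ (j + k + 1)))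
        = (3 * q + 6) * q * fact j / m ^ (j + 5)"
    proof -
      have "(\<Sum>k<5. (if k = 0 then t ^ 4 else if k = 1 then - 4 * t ^ 3 else
        if k = 2 then 6 * t\<^sup>2 else if k = 3 then - 4 * t else 1) * (fact (j + k) / m ^ (j + k + 1)))
        = t ^ 4 * (fact j / m ^ (j + 1)) + - 4 * t ^ 3 * (fact (j + 1) / m ^ (j + 2))
          + 6 * t\<^sup>2 * (fact (j + 2) / m ^ (j + 3)) + - 4 * t * (fact (j + 3) / m ^ (j + 4))
          + fact (j + 4) / m ^ (j + 5)"
        by (simp add: eval_nat_numeral)
      \<comment> \<open>With \<open>t = q / m\<close> every term carries
        \<open>fact j / m ^ (j + 5)\<close>. The quartic and cubic parts of the remaining polynomial
        in \<open>q\<close> cancel, and this drop in degree is what makes the moment decay in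
        \<open>j\<close>.\<close>
      also have "\<dots> = (q ^ 4 - 4 * q ^ 3 * q + 6 * q\<^sup>2 * (q + 1) * q - 4 * q * (q + 2) * (q + 1) * q
          + (q + 3) * (q + 2) * (q + 1) * q) * fact j / m ^ (j + 5)"
        unfolding fact_rising m(2) using m(1)
        by (simp add: field_simps power_add eval_nat_numeral q_def)
      also have "q ^ 4 - 4 * q ^ 3 * q + 6 * q\<^sup>2 * (q + 1) * q - 4 * q * (q + 2) * (q + 1) * q
          + (q + 3) * (q + 2) * (q + 1) * q = (3 * q + 6) * q"
        by (simp add: algebra_simps eval_nat_numeral)
      finally show ?thesis .
    qed
  qed (simp add: eval_nat_numeral algebra_simps)
  moreover have "c * ((3 * q + 6) * q * fact j / m ^ (j + 5)) = (3 * real (Suc j) + 6) * t\<^sup>2 / (real (Suc j))\<^sup>2"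
  proof -
    have e: "m ^ (j + 5) = m ^ (j + 3) * m\<^sup>2" by (simp add: eval_nat_numeral)
    have sj: "real (Suc j) = q" by (simp add: q_def)
    show ?thesis
      unfolding c_def f m(2) e sj using m(1) q by (simp add: field_simps power2_eq_square)
  qed
  ultimately show "has_improper_integral (\<lambda>s. pw_kernel j t s * (s - t) ^ 3)
      ((3 * real (Suc j) + 6) * t\<^sup>2 / (real (Suc j))\<^sup>2)" by simp
qed

text \<open>The moments 0 and 1 remove the first-order Taylor polynomial of \<open>G\<close> at
  \<open>t\<close>. The remainder is at most
  \<open>e * \<bar>s - t\<bar> + K * \<bar>s - t\<bar> ^ 3\<close>: differentiability gives the
  first term near \<open>t\<close>, boundedness the second one far away. Weighted with the kernel,
  the first integrates to \<open>e\<close> and the second tends to 0.\<close>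

lemma pw_kernel_approximates:
  fixes G :: "real \<Rightarrow> 'b::banach"
  assumes G: "continuous_on {0..} G" and B: "\<And>s. s \<ge> 0 \<Longrightarrow> norm (G s) \<le> B"
    and t: "t > 0" and G': "(G has_vector_derivative g) (at t)"
    and P: "\<And>j. has_improper_integral (\<lambda>s. pw_kernel j t s *\<^sub>R G s) (P j)"
  shows "P \<longlonglongrightarrow> g"
proof (rule LIMSEQ_I)
  fix r :: real assume r: "r > 0"
  define e where "e = r / 2"
  have e: "e > 0" using r by (simp add: e_def)
  obtain d where d: "d > 0" "\<And>s. \<bar>s - t\<bar> < d \<Longrightarrow> norm (G s - G t - (s - t) *\<^sub>R g) \<le> e * \<bar>s - t\<bar>"
    using G' e unfolding has_vector_derivative_def has_derivative_at_alt by fastforce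
  \<comment> \<open>At distance at least \<open>d\<close> from \<open>t\<close>, the constant part
    \<open>2 * B\<close> of the bound is raised to a cubic by
    \<open>(\<bar>s - t\<bar> / d) ^ 3 \<ge> 1\<close>, and the linear part by the square of the
    same ratio.\<close>
  define K where "K = 2 * B / d ^ 3 + norm g / d\<^sup>2"
  have B0: "B \<ge> 0" using B[of 0] by (simp add: order_trans[OF norm_ge_zero])
  have K0: "K \<ge> 0" using B0 d by (simp add: K_def)
  have le: "norm (G s - G t - (s - t) *\<^sub>R g) \<le> e * \<bar>s - t\<bar> + K * \<bar>s - t\<bar> ^ 3" if s: "s > 0" for s
  proof (cases "\<bar>s - t\<bar> < d")
    case True
    then show ?thesis using d(2)[OF True] K0 by (simp add: add_increasing2)
  next
    case False
    let ?u = "\<bar>s - t\<bar>"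
    have u: "?u \<ge> d" using False by simp
    have "norm (G s - G t - (s - t) *\<^sub>R g) \<le> norm (G s) + norm (G t) + ?u * norm g"
      using norm_triangle_ineq4[of "G s - G t" "(s - t) *\<^sub>R g"] norm_triangle_ineq4[of "G s" "G t"] by simp
    also have "\<dots> \<le> 2 * B + ?u * norm g"
      using B[of s] B[of t] s t by simp
    also have "\<dots> \<le> 2 * B * (?u / d) ^ 3 + ?u * norm g * (?u / d)\<^sup>2"
    proof (rule add_mono)
      have 1: "1 \<le> (?u / d) ^ n" for n using u d by (intro one_le_power) simp
      show "2 * B \<le> 2 * B * (?u / d) ^ 3"
        using mult_left_mono[OF 1[of 3], of "2 * B"] B0 by simp
      show "?u * norm g \<le> ?u * norm g * (?u / d)\<^sup>2"
        using mult_left_mono[OF 1[of 2], of "?u * norm g"] by simp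
    qed
    also have "\<dots> = K * ?u ^ 3"
      using d(1) by (simp add: K_def field_simps eval_nat_numeral)
    finally show ?thesis using e by (simp add: add_increasing)
  qed
  have main: "norm (P j - g) \<le> e + K * ((3 * real (Suc j) + 6) * t\<^sup>2 / (real (Suc j))\<^sup>2)" for j
  proof -
    let ?w = "pw_kernel j t"
    note M = pw_kernel_moments[OF t, of j]
    note cw = continuous_on_pw_kernel[of "{0..}" j t]
    have "has_improper_integral (\<lambda>s. ?w s *\<^sub>R G s - ?w s *\<^sub>R G t - (?w s * (s - t)) *\<^sub>R g)
        (P j - 0 *\<^sub>R G t - 1 *\<^sub>R g)"
      by (intro has_improper_integral_diff P continuous_intros cw G
          has_improper_integral_linear[OF M(1) _ bounded_linear_scaleR_left]
          has_improper_integral_linear[OF M(2) _ bounded_linear_scaleR_left])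
    then have "has_improper_integral (\<lambda>s. ?w s *\<^sub>R (G s - G t - (s - t) *\<^sub>R g)) (P j - g)"
      by (simp add: scaleR_diff_right)
    moreover have "has_improper_integral (\<lambda>s. e *\<^sub>R (?w s * (s - t)) + K *\<^sub>R (?w s * (s - t) ^ 3))
        (e *\<^sub>R 1 + K *\<^sub>R ((3 * real (Suc j) + 6) * t\<^sup>2 / (real (Suc j))\<^sup>2))"
      by (intro has_improper_integral_add has_improper_integral_scaleR M continuous_intros cw)
    ultimately have "norm (P j - g) \<le> e *\<^sub>R 1 + K *\<^sub>R ((3 * real (Suc j) + 6) * t\<^sup>2 / (real (Suc j))\<^sup>2)"
    proof (rule norm_improper_integral_le)
      show "continuous_on {0..} (\<lambda>s. ?w s *\<^sub>R (G s - G t - (s - t) *\<^sub>R g))"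
        by (intro continuous_intros cw G)
      show "(\<lambda>s. e *\<^sub>R (?w s * (s - t)) + K *\<^sub>R (?w s * (s - t) ^ 3)) integrable_on {0..T}" for T
        by (intro integrable_on_halfline[OF _ order_refl] continuous_intros cw)
      show "norm (?w s *\<^sub>R (G s - G t - (s - t) *\<^sub>R g)) \<le> e *\<^sub>R (?w s * (s - t)) + K *\<^sub>R (?w s * (s - t) ^ 3)"
        if s: "s > 0" for s
      proof -
        \<comment> \<open>The kernel has the sign of \<open>s - t\<close>. Hence absolute values
          disappear in odd moments, and the bound integrates exactly.\<close>
        have w: "\<bar>?w s\<bar> * \<bar>s - t\<bar> = ?w s * (s - t)"
        proof -
          have "?w s * (s - t) = (Suc j / t) ^ (j + 3) / fact (Suc j) * ((s - t)\<^sup>2 * s ^ j * exp (- (Suc j / t * s)))"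
            by (simp add: pw_kernel_def power2_eq_square)
          also have "\<dots> \<ge> 0" using s t by simp
          finally show ?thesis by (simp flip: abs_mult)
        qed
        have "norm (?w s *\<^sub>R (G s - G t - (s - t) *\<^sub>R g)) \<le> \<bar>?w s\<bar> * (e * \<bar>s - t\<bar> + K * \<bar>s - t\<bar> ^ 3)"
          using le[OF s] by (simp add: mult_left_mono)
        also have "\<dots> = e * (\<bar>?w s\<bar> * \<bar>s - t\<bar>) + K * (\<bar>?w s\<bar> * \<bar>s - t\<bar> * \<bar>s - t\<bar>\<^sup>2)"
          by (simp add: algebra_simps eval_nat_numeral)
        also have "\<dots> = e *\<^sub>R (?w s * (s - t)) + K *\<^sub>R (?w s * (s - t) ^ 3)"
          unfolding w by (simp add: power2_eq_square power3_eq_cube mult_ac)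
        finally show ?thesis .
      qed
    qed
    then show ?thesis by simp
  qed
  have "(\<lambda>j. K * ((3 * real (Suc j) + 6) * t\<^sup>2 / (real (Suc j))\<^sup>2)) \<longlonglongrightarrow> 0"
    by real_asymp
  then have "\<forall>\<^sub>F j in sequentially. K * ((3 * real (Suc j) + 6) * t\<^sup>2 / (real (Suc j))\<^sup>2) < e"
    using e by (rule order_tendstoD(2))
  then have "\<forall>\<^sub>F j in sequentially. norm (P j - g) < r"
  proof (rule eventually_mono)
    fix j assume "K * ((3 * real (Suc j) + 6) * t\<^sup>2 / (real (Suc j))\<^sup>2) < e"
    then show "norm (P j - g) < r" using main[of j] unfolding e_def by linarith
  qed
  then show "\<exists>N. \<forall>n\<ge>N. norm (P n - g) < r"
    by (simp add: eventually_sequentially)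
qed

lemma bounded_of_tendsto_at_top:
  fixes G :: "real \<Rightarrow> 'b::real_normed_vector"
  assumes "continuous_on {0..} G" "(G \<longlongrightarrow> L) at_top"
  obtains B where "\<And>s. s \<ge> 0 \<Longrightarrow> norm (G s) \<le> B"
proof -
  have "\<forall>\<^sub>F s in at_top. dist (G s) L < 1"
    using assms(2) by (rule tendstoD) simp
  then obtain T where T: "\<And>s. s \<ge> T \<Longrightarrow> dist (G s) L < 1"
    by (auto simp: eventually_at_top_linorder)
  have "compact (G ` {0..T})"
    by (intro compact_continuous_image continuous_on_subset[OF assms(1)]) auto
  then obtain C where C: "\<And>s. s \<in> {0..T} \<Longrightarrow> norm (G s) \<le> C"
    using compact_imp_bounded bounded_iff by (metis imageI)
  have "norm (G s) \<le> max C (norm L + 1)" if "s \<ge> 0" for s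
  proof (cases "s \<le> T")
    case True
    then show ?thesis using C[of s] that by auto
  next
    case False
    then have "norm (G s) \<le> norm L + 1"
      using T[of s] norm_triangle_ineq2[of "G s" L] by (simp add: dist_norm)
    then show ?thesis by simp
  qed
  then show thesis by (rule that)
qed

text \<open>\<open>D\<close> may be any chain of successive derivatives starting from the transform:
  in one application it consists of resolvent derivatives at a vector, in the other of
  zeros.\<close>

theorem post_widder:
  fixes f :: "real \<Rightarrow> 'b::banach" and D :: "nat \<Rightarrow> real \<Rightarrow> 'b"
  assumes f: "continuous_on {0..} f"
    and lap: "\<And>l. l > w \<Longrightarrow> has_laplace f l (D 0 l)"
    and D: "\<And>n l. l > w \<Longrightarrow> (D n has_vector_derivative D (Suc n) l) (at l)"
    and b: "b > w" and t: "t > 0"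
  shows "(\<lambda>j. ((- 1) ^ Suc j / fact (Suc j) * (Suc j / t) ^ (j + 2)) *\<^sub>R D (Suc j) (b + Suc j / t))
    \<longlonglongrightarrow> exp (- (b * t)) *\<^sub>R f t"
proof -
  define g where "g s = exp (- (b * s)) *\<^sub>R f s" for s
  define G where "G T = integral {0..T} g" for T
  have g: "continuous_on {0..} g"
    unfolding g_def by (intro continuous_intros f)
  have G: "continuous_on {0..} G"
    unfolding G_def by (rule continuous_on_primitive[OF g])
  have "(G \<longlongrightarrow> D 0 b) at_top"
    using lap[OF b] by (simp add: has_laplace_def has_improper_integral_def G_def[abs_def] g_def[abs_def])
  then obtain B where B: "\<And>s. s \<ge> 0 \<Longrightarrow> norm (G s) \<le> B"
    using bounded_of_tendsto_at_top[OF G] by metis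
  have G_exp: "exp_bounded G 0"
    unfolding exp_bounded_def
  proof (intro conjI allI impI G)
    fix c :: real assume c: "c > 0"
    have "norm (G s) \<le> B * exp (c * s)" if "s \<ge> 0" for s
    proof -
      have "B \<ge> 0" using B[of 0] by (simp add: order_trans[OF norm_ge_zero])
      then have "B * 1 \<le> B * exp (c * s)"
        using that c by (intro mult_left_mono) auto
      then show ?thesis using B[OF that] by simp
    qed
    then show "\<exists>C. \<forall>s\<ge>0. norm (G s) \<le> C * exp (c * s)" by blast
  qed
  \<comment> \<open>\<open>G\<close> is bounded, so its transform may be differentiated under the
    integral; \<open>H n\<close> is the n-th derivative.\<close>
  define H where "H n m = laplace (\<lambda>s. (- s) ^ n *\<^sub>R G s) m" for n m
  have H: "has_laplace (\<lambda>s. (- s) ^ n *\<^sub>R G s) m (H n m)" if "m > 0" for n m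
    unfolding H_def by (rule has_laplace_laplace[OF exp_bounded_moment[OF G_exp] that])
  have H': "(H n has_vector_derivative H (Suc n) m) (at m)" if "m > 0" for n m
    unfolding H_def[abs_def] by (rule laplace_moment_has_vector_derivative[OF G_exp that])
  have H0: "H 0 m = (1 / m) *\<^sub>R D 0 (b + m)" if m: "m > 0" for m
  proof -
    have "has_laplace g m (D 0 (b + m))"
    proof -
      have "exp (- (m * s)) *\<^sub>R g s = exp (- ((b + m) * s)) *\<^sub>R f s" for s
        by (simp add: g_def algebra_simps flip: exp_add)
      then show ?thesis using lap[of "b + m"] b m by (simp add: has_laplace_def)
    qed
    moreover have "((\<lambda>T. exp (- (m * T)) *\<^sub>R integral {0..T} g) \<longlongrightarrow> 0) at_top"
    proof (rule Lim_null_comparison)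
      show "\<forall>\<^sub>F T in at_top. norm (exp (- (m * T)) *\<^sub>R integral {0..T} g) \<le> exp (- (m * T)) * B"
        by (rule eventually_mono[OF eventually_ge_at_top[of 0]]) (use B in \<open>auto simp: G_def\<close>)
      show "((\<lambda>T. exp (- (m * T)) * B) \<longlongrightarrow> 0) at_top"
        using m by real_asymp
    qed
    ultimately have "has_laplace G m ((1 / m) *\<^sub>R D 0 (b + m))"
      unfolding G_def[abs_def] using m by (intro has_laplace_primitive[OF g]) auto
    moreover have "has_laplace G m (H 0 m)" using H[OF m, of 0] by simp
    ultimately show ?thesis by (rule has_laplace_unique[rotated])
  qed
  \<comment> \<open>Leibniz rule for the n-th derivative of \<open>m *\<^sub>R H 0 m\<close>, which
    is \<open>D 0 (b + m)\<close>. At \<open>n = 0\<close> the truncated \<open>n - 1\<close> is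
    harmless, as its factor is 0.\<close>
  define E where "E n m = m *\<^sub>R H n m + real n *\<^sub>R H (n - 1) m" for n m
  have DE: "D n (b + m) = E n m" if "m > 0" for n m
  proof (rule derivative_chain_unique[where D = "\<lambda>n m. D n (b + m)" and E = E and w = 0, OF _ _ _ that])
    fix m :: real and k assume m: "m > 0"
    have "((\<lambda>m. b + m) has_vector_derivative 1) (at m)"
      by (auto intro!: derivative_eq_intros)
    from vector_diff_chain_at[OF this, of "D k" "D (Suc k) (b + m)"] D[of "b + m" k] b m
    show "((\<lambda>m. D k (b + m)) has_vector_derivative D (Suc k) (b + m)) (at m)"
      by (simp add: o_def)
    have "((\<lambda>m. real k *\<^sub>R H (k - 1) m) has_vector_derivative real k *\<^sub>R H k m) (at m)"
    proof (cases k)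
      case (Suc i)
      then show ?thesis
        using has_vector_derivative_scaleR[OF DERIV_const[of "real k"] H'[OF m, of i]] by simp
    qed simp
    moreover have "((\<lambda>m. m *\<^sub>R H k m) has_vector_derivative m *\<^sub>R H (Suc k) m + 1 *\<^sub>R H k m) (at m)"
      by (rule has_vector_derivative_scaleR[OF DERIV_ident H'[OF m]])
    ultimately have "(E k has_vector_derivative m *\<^sub>R H (Suc k) m + 1 *\<^sub>R H k m + real k *\<^sub>R H k m) (at m)"
      unfolding E_def[abs_def] by (intro has_vector_derivative_add)
    then show "(E k has_vector_derivative E (Suc k) m) (at m)"
      by (simp add: E_def algebra_simps)
  next
    fix m :: real assume "m > 0"
    then show "D 0 (b + m) = E 0 m" by (simp add: E_def H0)
  qed
  define P where "P j = ((- 1) ^ Suc j / fact (Suc j) * (Suc j / t) ^ (j + 2)) *\<^sub>R D (Suc j) (b + Suc j / t)" for j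
  have P: "has_improper_integral (\<lambda>s. pw_kernel j t s *\<^sub>R G s) (P j)" for j
  proof -
    define m where "m = Suc j / t"
    have m: "m > 0" using t by (simp add: m_def)
    have mt: "real (Suc j) = m * t" using t by (simp add: m_def)
    let ?h = "\<lambda>n s. exp (- (m * s)) *\<^sub>R (- s) ^ n *\<^sub>R G s"
    let ?c = "(- 1) ^ Suc j / fact (Suc j) * m ^ (j + 2)"
    have "has_improper_integral (\<lambda>s. ?c *\<^sub>R (m *\<^sub>R ?h (Suc j) s + real (Suc j) *\<^sub>R ?h j s))
      (?c *\<^sub>R (m *\<^sub>R H (Suc j) m + real (Suc j) *\<^sub>R H j m))"
      using H[OF m, of "Suc j"] H[OF m, of j] unfolding has_laplace_def
      by (intro has_improper_integral_scaleR has_improper_integral_add continuous_intros G)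
    moreover have "?c *\<^sub>R (m *\<^sub>R H (Suc j) m + real (Suc j) *\<^sub>R H j m) = P j"
      unfolding P_def m_def[symmetric] DE[OF m] E_def diff_Suc_1 ..
    moreover have "?c *\<^sub>R (m *\<^sub>R ?h (Suc j) s + real (Suc j) *\<^sub>R ?h j s) = pw_kernel j t s *\<^sub>R G s" for s
    proof -
      have "?c *\<^sub>R (m *\<^sub>R ?h (Suc j) s + real (Suc j) *\<^sub>R ?h j s) =
          (?c * (m * (exp (- (m * s)) * (- s) ^ Suc j) + real (Suc j) * (exp (- (m * s)) * (- s) ^ j))) *\<^sub>R G s"
        by (simp only: scaleR_scaleR scaleR_add_left[symmetric])
      \<comment> \<open>Since \<open>Suc j = m * t\<close>, the bracket is
        \<open>m * (- s) ^ j * (t - s)\<close> times the exponential. Turning \<open>t - s\<close>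
        into \<open>s - t\<close> uses up one sign of \<open>?c\<close>, and the other signs pair
        off.\<close>
      also have "?c * (m * (exp (- (m * s)) * (- s) ^ Suc j) + real (Suc j) * (exp (- (m * s)) * (- s) ^ j)) =
          ((- 1) ^ j * (- 1) ^ j) * (m ^ (j + 2) / fact (Suc j) * (m * (s - t) * s ^ j * exp (- (m * s))))"
        unfolding mt power_minus[of s] by (simp add: algebra_simps add_divide_distrib diff_divide_distrib del: fact_Suc)
      also have "\<dots> = pw_kernel j t s"
      proof -
        have "m ^ (j + 3) = m ^ (j + 2) * m" by (simp add: eval_nat_numeral)
        moreover have "(- 1 :: real) ^ j * (- 1) ^ j = 1" by (simp flip: power_mult_distrib)
        ultimately show ?thesis
          unfolding pw_kernel_def m_def[symmetric] by (simp only: times_divide_eq_left times_divide_eq_right mult_1_left mult.assoc)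
      qed
      finally show ?thesis .
    qed
    ultimately show ?thesis by simp
  qed
  have "(G has_vector_derivative g t) (at t)"
    unfolding G_def[abs_def] by (rule primitive_has_vector_derivative[OF g t])
  from pw_kernel_approximates[OF G B t this P]
  show ?thesis by (simp add: P_def[abs_def] g_def)
qed

text \<open>With the chain of zeros, the inversion formula exhibits a multiple of \<open>f t\<close>
  as a limit of zeros.\<close>

corollary laplace_injective:
  fixes f :: "real \<Rightarrow> 'b::banach"
  assumes "continuous_on {0..} f" "\<And>l. l > w \<Longrightarrow> has_laplace f l 0" "t > 0"
  shows "f t = 0"
proof -
  have "(\<lambda>j. 0) \<longlonglongrightarrow> exp (- ((w + 1) * t)) *\<^sub>R f t"
    using post_widder[of f w "\<lambda>_ _. 0" "w + 1" t] assms by simp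
  then have "exp (- ((w + 1) * t)) *\<^sub>R f t = 0"
    using LIMSEQ_unique tendsto_const by metis
  then show ?thesis by simp
qed

subsection \<open>Resolvents of linear relations\<close>

lemma shifted_inverse_eq_op_graph_iff:
  "shifted_inverse l A = op_graph R \<longleftrightarrow> (\<forall>x y. (x, y) \<in> A \<longleftrightarrow> R (l *\<^sub>R x - y) = x)"
proof -
  have 1: "(u, x) \<in> shifted_inverse l A \<longleftrightarrow> (x, l *\<^sub>R x - u) \<in> A" for u x
    unfolding shifted_inverse_def by force
  have 2: "(u, x) \<in> op_graph R \<longleftrightarrow> R u = x" for u x
    unfolding op_graph_def by auto
  have "shifted_inverse l A = op_graph R \<longleftrightarrow> (\<forall>x u. (x, l *\<^sub>R x - u) \<in> A \<longleftrightarrow> R u = x)"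
    unfolding set_eq_iff split_paired_All 1 2 by blast
  also have "\<dots> \<longleftrightarrow> (\<forall>x y. (x, y) \<in> A \<longleftrightarrow> R (l *\<^sub>R x - y) = x)"
  proof (rule iffI; intro allI)
    fix x y assume "\<forall>x u. (x, l *\<^sub>R x - u) \<in> A \<longleftrightarrow> R u = x"
    from this[rule_format, of x "l *\<^sub>R x - y"]
    show "(x, y) \<in> A \<longleftrightarrow> R (l *\<^sub>R x - y) = x" by simp
  next
    fix x u assume "\<forall>x y. (x, y) \<in> A \<longleftrightarrow> R (l *\<^sub>R x - y) = x"
    from this[rule_format, of x "l *\<^sub>R x - u"]
    show "(x, l *\<^sub>R x - u) \<in> A \<longleftrightarrow> R u = x" by simp
  qed
  finally show ?thesis .
qed

lemma op_graph_inject: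
  assumes "op_graph R = op_graph Q"
  shows "R = Q"
proof (rule blinfun_eqI)
  fix x
  have "(x, R x) \<in> op_graph R" by (auto simp: op_graph_def)
  then show "R x = Q x" unfolding assms by (auto simp: op_graph_def)
qed

lemma resolvent_eqI:
  assumes "shifted_inverse l A = op_graph R"
  shows "l \<in> resolvent_set A" "resolvent l A = R"
proof -
  show "l \<in> resolvent_set A" using assms unfolding resolvent_set_def by blast
  show "resolvent l A = R"
    unfolding resolvent_def assms by (rule the_equality) (auto dest: op_graph_inject)
qed

text \<open>One resolvent determines the whole relation. With this test the resolvent algebra never
  inverts an operator, so it covers multivalued \<open>A\<close>.\<close>

lemma mem_iff_resolvent:
  assumes "l \<in> resolvent_set A"
  shows "(x, y) \<in> A \<longleftrightarrow> resolvent l A (l *\<^sub>R x - y) = x"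
proof -
  obtain R where "shifted_inverse l A = op_graph R"
    using assms unfolding resolvent_set_def by blast
  then show ?thesis
    using resolvent_eqI(2)[of l A R] shifted_inverse_eq_op_graph_iff[of l A R] by blast
qed

lemma resolvent_identity:
  assumes "l \<in> resolvent_set A" "m \<in> resolvent_set A"
  shows "resolvent l A u - resolvent m A u = (m - l) *\<^sub>R resolvent l A (resolvent m A u)"
proof -
  let ?v = "resolvent m A u"
  have "(?v, m *\<^sub>R ?v - u) \<in> A"
    using mem_iff_resolvent[OF assms(2)] by simp
  then have "resolvent l A (l *\<^sub>R ?v - (m *\<^sub>R ?v - u)) = ?v"
    using mem_iff_resolvent[OF assms(1)] by simp
  then show ?thesis
    by (simp add: blinfun.bilinear_simps algebra_simps)
qed

text \<open>Exchanging \<open>l\<close> and \<open>m\<close> in the resolvent identity changes the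
  sign of the left side and of the scalar factor alike, so the two products must agree.\<close>

lemma resolvent_commute:
  assumes "l \<in> resolvent_set A" "m \<in> resolvent_set A"
  shows "resolvent l A (resolvent m A u) = resolvent m A (resolvent l A u)"
proof (cases "l = m")
  case False
  have "(m - l) *\<^sub>R resolvent l A (resolvent m A u) = (m - l) *\<^sub>R resolvent m A (resolvent l A u)"
  proof -
    have "(m - l) *\<^sub>R resolvent m A (resolvent l A u) = - ((l - m) *\<^sub>R resolvent m A (resolvent l A u))"
      by (simp flip: scaleR_minus_left)
    also have "\<dots> = resolvent l A u - resolvent m A u"
      unfolding resolvent_identity[OF assms(2,1), symmetric] by simp
    finally show ?thesis unfolding resolvent_identity[OF assms] ..
  qed
  with False show ?thesis by simp
qed simp

text \<open>Enlarges the known resolvent set: membership in \<open>A\<close> is tested with the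
  resolvent at \<open>c\<close>, and the two equations convert that test into the one for
  \<open>Q\<close> at \<open>l\<close>. One direction needs \<open>1\<close> and \<open>2\<close>,
  the other \<open>1\<close> alone.\<close>

lemma pseudo_resolvent_shifted_inverse:
  fixes Q :: "'a::real_normed_vector \<Rightarrow>\<^sub>L 'a"
  assumes c: "c \<in> resolvent_set A"
    and 1: "\<And>x. Q x - resolvent c A x = (c - l) *\<^sub>R resolvent c A (Q x)"
    and 2: "\<And>x. Q (resolvent c A x) = resolvent c A (Q x)"
  shows "shifted_inverse l A = op_graph Q"
  unfolding shifted_inverse_eq_op_graph_iff mem_iff_resolvent[OF c]
proof (intro allI iffI)
  let ?R = "resolvent c A"
  fix x y assume x: "?R (c *\<^sub>R x - y) = x"
  let ?v = "c *\<^sub>R x - y"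
  have "l *\<^sub>R x - y = ?v - (c - l) *\<^sub>R ?R ?v"
    unfolding x by (simp add: algebra_simps)
  then have "Q (l *\<^sub>R x - y) = Q ?v - (c - l) *\<^sub>R Q (?R ?v)"
    by (simp only: blinfun.bilinear_simps)
  also have "\<dots> = ?R ?v"
    unfolding 2 1[symmetric] by simp
  finally show "Q (l *\<^sub>R x - y) = x" unfolding x .
next
  let ?R = "resolvent c A"
  fix x y assume x: "Q (l *\<^sub>R x - y) = x"
  let ?z = "l *\<^sub>R x - y"
  have "c *\<^sub>R x - y = (c - l) *\<^sub>R Q ?z + ?z"
    unfolding x by (simp add: algebra_simps)
  then have "?R (c *\<^sub>R x - y) = (c - l) *\<^sub>R ?R (Q ?z) + ?R ?z"
    by (simp only: blinfun.bilinear_simps)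
  also have "\<dots> = Q ?z"
    unfolding 1[symmetric] by simp
  finally show "?R (c *\<^sub>R x - y) = x" unfolding x .
qed

section \<open>Smoothness of the resolvent in operator norm\<close>

lemma resolvent_has_vector_derivative:
  fixes A :: "('a::real_normed_vector \<times> 'a) set"
  assumes U: "{b<..} \<subseteq> resolvent_set A" and l: "l > b"
  shows "((\<lambda>l. resolvent l A) has_vector_derivative - (resolvent l A o\<^sub>L resolvent l A)) (at l)"
proof -
  let ?R = "\<lambda>l. resolvent l A"
  define N where "N = norm (?R l)"
  \<comment> \<open>The first bound keeps \<open>l + h\<close> in the half-line; the second gives
    \<open>\<bar>h\<bar> * N \<le> 1 / 2\<close>, with \<open>N + 1\<close> to cover
    \<open>N = 0\<close>. Then half of \<open>norm ?Q\<close> can be absorbed on the left, which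
    gives \<open>norm ?Q \<le> 2 * N\<close>.\<close>
  define d where "d = min (l - b) (1 / (2 * (N + 1)))"
  have N: "N \<ge> 0" by (simp add: N_def)
  then have d: "d > 0" using l by (simp add: d_def)
  show ?thesis
  proof (rule has_vector_derivativeI_quadratic[OF d, where K = "2 * N ^ 3"])
    fix h assume h: "\<bar>h\<bar> < d"
    then have lh: "l + h > b" by (auto simp: d_def)
    let ?Q = "?R (l + h)"
    have res: "?Q - ?R l = (- h) *\<^sub>R (?Q o\<^sub>L ?R l)"
      by (rule blinfun_eqI)
        (use resolvent_identity[of "l + h" A l] U l lh in \<open>auto simp: blinfun.bilinear_simps\<close>)
    have "\<bar>h\<bar> * N \<le> 1 / 2"
    proof -
      have "\<bar>h\<bar> * N \<le> (1 / (2 * (N + 1))) * (N + 1)"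
        using h N by (intro mult_mono) (auto simp: d_def)
      also have "\<dots> = 1 / 2" using N by simp
      finally show ?thesis .
    qed
    have "norm ?Q \<le> N + norm (?Q - ?R l)"
      using norm_triangle_sub[of ?Q "?R l"] by (simp add: N_def)
    also have "\<dots> \<le> N + \<bar>h\<bar> * (norm ?Q * N)"
      unfolding res using norm_blinfun_compose[of ?Q "?R l"] by (simp add: N_def mult_left_mono)
    also have "\<dots> \<le> N + norm ?Q / 2"
      using mult_left_mono[OF \<open>\<bar>h\<bar> * N \<le> 1 / 2\<close>, of "norm ?Q"] by (simp add: mult_ac)
    finally have Q: "norm ?Q \<le> 2 * N" by simp
    have "?Q - ?R l - h *\<^sub>R - (?R l o\<^sub>L ?R l) = (- h) *\<^sub>R (?Q o\<^sub>L ?R l) - h *\<^sub>R - (?R l o\<^sub>L ?R l)"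
      unfolding res ..
    \<comment> \<open>This exposes the difference of resolvents again, so that a second use of
      \<open>res\<close> yields the factor \<open>h\<^sup>2\<close>.\<close>
    also have "\<dots> = (- h) *\<^sub>R ((?Q - ?R l) o\<^sub>L ?R l)"
      by (rule blinfun_eqI) (simp add: blinfun.bilinear_simps algebra_simps)
    also have "\<dots> = (- h) *\<^sub>R (((- h) *\<^sub>R (?Q o\<^sub>L ?R l)) o\<^sub>L ?R l)"
      unfolding res ..
    also have "\<dots> = h\<^sup>2 *\<^sub>R (?Q o\<^sub>L ?R l o\<^sub>L ?R l)"
      by (rule blinfun_eqI) (simp add: blinfun.bilinear_simps power2_eq_square)
    finally have eq: "norm (?Q - ?R l - h *\<^sub>R - (?R l o\<^sub>L ?R l)) = h\<^sup>2 * norm (?Q o\<^sub>L ?R l o\<^sub>L ?R l)"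
      by (simp only: norm_scaleR abs_power2)
    have "norm (?Q o\<^sub>L ?R l o\<^sub>L ?R l) \<le> norm (?Q o\<^sub>L ?R l) * N"
      unfolding N_def by (rule norm_blinfun_compose)
    also have "\<dots> \<le> (norm ?Q * N) * N"
      using norm_blinfun_compose[of ?Q "?R l"] N by (intro mult_right_mono) (simp_all add: N_def)
    also have "\<dots> \<le> (2 * N * N) * N"
      using Q N by (intro mult_right_mono) auto
    finally have "h\<^sup>2 * norm (?Q o\<^sub>L ?R l o\<^sub>L ?R l) \<le> h\<^sup>2 * (2 * N * N * N)"
      by (rule mult_left_mono) simp
    then show "norm (?R (l + h) - ?R l - h *\<^sub>R - (?R l o\<^sub>L ?R l)) \<le> 2 * N ^ 3 * h\<^sup>2"
      unfolding eq by (simp add: power3_eq_cube mult_ac)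
  qed
qed

text \<open>A class of functions that contains \<open>l powr (-\<kappa>) R(l)\<close> and is closed under differentiation, because \<open>R' = - R R\<close>.\<close>

inductive resolvent_algebra :: "('a::real_normed_vector \<times> 'a) set \<Rightarrow> (real \<Rightarrow> 'a \<Rightarrow>\<^sub>L 'a) \<Rightarrow> bool"
  for A where
  base: "resolvent_algebra A (\<lambda>l. resolvent l A)"
| comp: "resolvent_algebra A f \<Longrightarrow> resolvent_algebra A g \<Longrightarrow> resolvent_algebra A (\<lambda>l. f l o\<^sub>L g l)"
| scale: "resolvent_algebra A f \<Longrightarrow> resolvent_algebra A (\<lambda>l. (c * l powr p) *\<^sub>R f l)"
| add: "resolvent_algebra A f \<Longrightarrow> resolvent_algebra A g \<Longrightarrow> resolvent_algebra A (\<lambda>l. f l + g l)"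

lemma resolvent_algebra_derivative:
  assumes "resolvent_algebra A f" and b: "b \<ge> 0" "{b<..} \<subseteq> resolvent_set A"
  shows "\<exists>g. resolvent_algebra A g \<and> (\<forall>l>b. (f has_vector_derivative g l) (at l))"
  using assms(1)
proof induction
  case base
  \<comment> \<open>The factor \<open>l powr 0\<close>, which is 1 for positive \<open>l\<close>,
    puts the derivative into the shape of the rule \<open>scale\<close>.\<close>
  have "((\<lambda>l. resolvent l A) has_vector_derivative (- 1 * l powr 0) *\<^sub>R (resolvent l A o\<^sub>L resolvent l A)) (at l)"
    if "l > b" for l
    using resolvent_has_vector_derivative[OF b(2) that] that b(1) by simp
  moreover have "resolvent_algebra A (\<lambda>l. (- 1 * l powr 0) *\<^sub>R (resolvent l A o\<^sub>L resolvent l A))"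
    by (rule resolvent_algebra.scale[OF resolvent_algebra.comp[OF resolvent_algebra.base resolvent_algebra.base]])
  ultimately show ?case by blast
next
  case (comp f g)
  then obtain f' g' where f': "resolvent_algebra A f'" "\<And>l. l > b \<Longrightarrow> (f has_vector_derivative f' l) (at l)"
    and g': "resolvent_algebra A g'" "\<And>l. l > b \<Longrightarrow> (g has_vector_derivative g' l) (at l)" by blast
  have "((\<lambda>l. f l o\<^sub>L g l) has_vector_derivative (f l o\<^sub>L g' l) + (f' l o\<^sub>L g l)) (at l)" if "l > b" for l
    by (rule bounded_bilinear.has_vector_derivative[OF bounded_bilinear_blinfun_compose f'(2)[OF that] g'(2)[OF that]])
  moreover have "resolvent_algebra A (\<lambda>l. (f l o\<^sub>L g' l) + (f' l o\<^sub>L g l))"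
    by (rule resolvent_algebra.add[OF resolvent_algebra.comp[OF comp.hyps(1) g'(1)] resolvent_algebra.comp[OF f'(1) comp.hyps(2)]])
  ultimately show ?case by blast
next
  case (scale f c p)
  then obtain f' where f': "resolvent_algebra A f'" "\<And>l. l > b \<Longrightarrow> (f has_vector_derivative f' l) (at l)"
    by blast
  have "((\<lambda>l. (c * l powr p) *\<^sub>R f l) has_vector_derivative
      (c * l powr p) *\<^sub>R f' l + (c * p * l powr (p - 1)) *\<^sub>R f l) (at l)" if l: "l > b" for l
  proof (rule has_vector_derivative_scaleR[OF _ f'(2)[OF l]])
    show "((\<lambda>l. c * l powr p) has_field_derivative c * p * l powr (p - 1)) (at l)"
      using l b(1) by (auto intro!: derivative_eq_intros simp: powr_diff)
  qed
  moreover have "resolvent_algebra A (\<lambda>l. (c * l powr p) *\<^sub>R f' l + (c * p * l powr (p - 1)) *\<^sub>R f l)"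
    by (rule resolvent_algebra.add[OF resolvent_algebra.scale[OF f'(1)] resolvent_algebra.scale[OF scale.hyps]])
  ultimately show ?case by blast
next
  case (add f g)
  then obtain f' g' where f': "resolvent_algebra A f'" "\<And>l. l > b \<Longrightarrow> (f has_vector_derivative f' l) (at l)"
    and g': "resolvent_algebra A g'" "\<And>l. l > b \<Longrightarrow> (g has_vector_derivative g' l) (at l)" by blast
  have "((\<lambda>l. f l + g l) has_vector_derivative f' l + g' l) (at l)" if "l > b" for l
    by (rule has_vector_derivative_add[OF f'(2)[OF that] g'(2)[OF that]])
  with resolvent_algebra.add[OF f'(1) g'(1)] show ?case by blast
qed

lemma nth_vector_derivative_Suc:
  "nth_vector_derivative (Suc n) f l = vector_derivative (nth_vector_derivative n f) (at l)"
  by (simp add: nth_vector_derivative_def)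

text \<open>\<open>vector_derivative\<close> is meaningful only where a derivative exists, so
  existence must be known at each order before the next one is taken. The iterates agree with
  members of the class for \<open>l > b\<close> only, which suffices because that set is
  open.\<close>

lemma nth_vector_derivative_resolvent_algebra:
  assumes "resolvent_algebra A f" and b: "b \<ge> 0" "{b<..} \<subseteq> resolvent_set A" and l: "l > b"
  shows "(nth_vector_derivative n f has_vector_derivative nth_vector_derivative (Suc n) f l) (at l)"
proof -
  have step: "\<exists>h. resolvent_algebra A h \<and> (\<forall>l>b. (nth_vector_derivative n f has_vector_derivative h l) (at l))"
    if g: "resolvent_algebra A g" "\<And>l. l > b \<Longrightarrow> nth_vector_derivative n f l = g l" for n g
  proof -
    obtain h where h: "resolvent_algebra A h" "\<And>l. l > b \<Longrightarrow> (g has_vector_derivative h l) (at l)"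
      using resolvent_algebra_derivative[OF g(1) b] by blast
    have "(nth_vector_derivative n f has_vector_derivative h l) (at l)" if "l > b" for l
      by (rule has_vector_derivative_transform_within_open[OF h(2)[OF that], of "{b<..}"])
        (use that g(2) in auto)
    with h(1) show ?thesis by blast
  qed
  have "\<exists>g. resolvent_algebra A g \<and> (\<forall>l>b. nth_vector_derivative n f l = g l)"
  proof (induction n)
    case 0
    show ?case using assms(1) by (auto simp: nth_vector_derivative_def)
  next
    case (Suc n)
    then obtain h where "resolvent_algebra A h" "\<And>l. l > b \<Longrightarrow> (nth_vector_derivative n f has_vector_derivative h l) (at l)"
      using step by blast
    then show ?case
      by (auto simp: nth_vector_derivative_Suc intro!: exI[of _ h] vector_derivative_at)
  qed
  then obtain h where "(nth_vector_derivative n f has_vector_derivative h l) (at l)"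
    using step l by blast
  then show ?thesis
    by (simp add: nth_vector_derivative_Suc vector_derivative_at)
qed

text \<open>Evaluation at \<open>x\<close> turns the operator-norm derivatives into a chain
  comparable with strong Laplace integrals.\<close>

lemma nth_vector_derivative_scaled_resolvent:
  fixes \<kappa> :: real
  assumes "b \<ge> 0" "{b<..} \<subseteq> resolvent_set A" "l > b"
  defines "F \<equiv> \<lambda>l. (1 / l powr \<kappa>) *\<^sub>R resolvent l A"
  shows "((\<lambda>l. nth_vector_derivative n F l x) has_vector_derivative nth_vector_derivative (Suc n) F l x) (at l)"
proof -
  have "F = (\<lambda>l. (1 * l powr (- \<kappa>)) *\<^sub>R resolvent l A)"
    by (simp add: F_def powr_minus_divide)
  then have "resolvent_algebra A F"
    by (simp only: resolvent_algebra.scale resolvent_algebra.base)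
  from nth_vector_derivative_resolvent_algebra[OF this assms(1-3), of n]
  show ?thesis
    by (rule bounded_linear.has_vector_derivative[OF blinfun.bounded_linear_left])
qed

subsection \<open>Growth bounds\<close>

lemma Gamma_ratio_tendsto_1:
  fixes \<alpha> :: real
  assumes "\<alpha> \<ge> 0"
  shows "(\<lambda>n. Gamma (real n + \<alpha> + 1) / (fact n * real n powr \<alpha>)) \<longlonglongrightarrow> 1"
proof -
  define z where "z = \<alpha> + 1"
  have z: "z > 0" using assms by (simp add: z_def)
  then have G: "Gamma z > 0" by (rule Gamma_real_pos)
  \<comment> \<open>The factor \<open>n / (n + z)\<close> compensates two shifts by one:
    \<open>Gamma_series\<close> has \<open>pochhammer z (n + 1)\<close>, which contributes
    \<open>n + z\<close>, and \<open>n\<close> to the power \<open>z\<close>, which is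
    \<open>n\<close> times \<open>n powr \<alpha>\<close>.\<close>
  have "(\<lambda>n. (n / (n + z)) * (Gamma z / Gamma_series z n)) \<longlonglongrightarrow> 1 * (Gamma z / Gamma z)"
  proof (intro tendsto_mult tendsto_divide tendsto_const Gamma_series_LIMSEQ)
    show "(\<lambda>n. real n / (real n + z)) \<longlonglongrightarrow> 1" by real_asymp
  qed (use G in simp)
  then have lim: "(\<lambda>n. (n / (n + z)) * (Gamma z / Gamma_series z n)) \<longlonglongrightarrow> 1" using G by simp
  show ?thesis
  proof (rule Lim_transform_eventually[OF lim], rule eventually_mono[OF eventually_gt_at_top[of 0]])
    fix n :: nat assume n: "n > 0"
    have "z \<notin> \<int>\<^sub>\<le>\<^sub>0" using z by (auto elim!: nonpos_Ints_cases)
    then have "pochhammer z (n + 1) = Gamma (z + real (n + 1)) / Gamma z"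
      by (rule pochhammer_Gamma)
    also have "z + real (n + 1) = (real n + z) + 1" by simp
    also have "Gamma \<dots> = (real n + z) * Gamma (real n + z)"
      using z by (intro Gamma_plus1) (auto elim!: nonpos_Ints_cases)
    finally have p: "pochhammer z (n + 1) = (real n + z) * Gamma (real n + z) / Gamma z" .
    have e: "exp (z * ln (real n)) = real n * real n powr \<alpha>"
      using n by (simp add: powr_def z_def algebra_simps exp_add)
    have cancel: "r / s * (G / (f * (r * p) / (s * g / G))) = g / (f * p)"
      if "r > 0" "s > 0" "G > 0" "f > 0" "p > 0" "g > 0" for r s G f p g :: real
      using that by (simp add: field_simps)
    have "Gamma (real n + z) > 0" using z by (intro Gamma_real_pos) auto
    moreover have "Gamma_series z n = fact n * (real n * real n powr \<alpha>) / ((real n + z) * Gamma (real n + z) / Gamma z)"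
      unfolding Gamma_series_def p e[symmetric] by simp
    moreover have "real n + \<alpha> + 1 = real n + z" by (simp add: z_def)
    ultimately show "real n / (real n + z) * (Gamma z / Gamma_series z n) =
        Gamma (real n + \<alpha> + 1) / (fact n * real n powr \<alpha>)"
      using n z G by (simp only: cancel) (rule cancel, auto)
  qed
qed

text \<open>This is the Post-Widder factor times the bound of assertion (2) at
  \<open>b + n / t\<close>, with \<open>d = b - \<omega>\<close>. The Gamma quotient supplies
  \<open>n powr \<alpha>\<close>; what is left of the powers is \<open>(1 + d * t / n)\<close> to
  the power \<open>- (n + \<alpha> + 1)\<close>, which tends to the exponential.\<close>

lemma widder_bound_tendsto:
  fixes \<alpha> d t :: real
  assumes "\<alpha> \<ge> 0" "d > 0" "t > 0"
  shows "(\<lambda>n. (n / t) ^ (n + 1) / fact n * (Gamma (n + \<alpha> + 1) / (n / t + d) powr (n + \<alpha> + 1)))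
    \<longlonglongrightarrow> t powr \<alpha> * exp (- (d * t))"
proof -
  have "(\<lambda>n. t powr \<alpha> * (1 + d * t / real n) powr - (real n + \<alpha> + 1)) \<longlonglongrightarrow> t powr \<alpha> * exp (- (d * t))"
    using assms by real_asymp
  from tendsto_mult[OF Gamma_ratio_tendsto_1[OF assms(1)] this]
  have lim: "(\<lambda>n. Gamma (real n + \<alpha> + 1) / (fact n * real n powr \<alpha>) *
      (t powr \<alpha> * (1 + d * t / real n) powr - (real n + \<alpha> + 1))) \<longlonglongrightarrow> t powr \<alpha> * exp (- (d * t))"
    by simp
  show ?thesis
  proof (rule Lim_transform_eventually[OF lim], rule eventually_mono[OF eventually_gt_at_top[of 0]])
    fix n :: nat assume n: "n > 0"
    define m where "m = real n / t"
    have m: "m > 0" "real n = m * t" using n assms by (auto simp: m_def)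
    have "1 + d * t / real n = (m + d) / m"
      unfolding m(2) using m(1) assms(3) by (simp add: field_simps)
    moreover have "((m + d) / m) powr - e = m powr e / (m + d) powr e" for e
      using m(1) assms(2) by (simp add: powr_minus powr_divide)
    ultimately have "(1 + d * t / real n) powr - (real n + \<alpha> + 1) = m powr (real n + \<alpha> + 1) / (m + d) powr (real n + \<alpha> + 1)"
      by (simp only:)
    moreover have "m powr (real n + \<alpha> + 1) = m ^ (n + 1) * m powr \<alpha>"
      using m(1) powr_realpow[of m "n + 1"] by (simp add: powr_add mult_ac)
    moreover have "real n powr \<alpha> = m powr \<alpha> * t powr \<alpha>"
      unfolding m(2) using m(1) assms(3) by (simp add: powr_mult)
    ultimately show "Gamma (real n + \<alpha> + 1) / (fact n * real n powr \<alpha>) *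
        (t powr \<alpha> * (1 + d * t / real n) powr - (real n + \<alpha> + 1)) =
        (n / t) ^ (n + 1) / fact n * (Gamma (n + \<alpha> + 1) / (n / t + d) powr (n + \<alpha> + 1))"
      using m(1) assms(3) by (simp add: field_simps flip: m_def)
  qed
qed

lemma has_laplace_transform_iff:
  fixes L :: "'a::banach \<Rightarrow>\<^sub>L 'a"
  shows "has_laplace_transform S l L \<longleftrightarrow> (\<forall>x. has_laplace (\<lambda>t. S t x) l (L x))"
  by (simp add: has_laplace_transform_def has_laplace_def has_improper_integral_def)

lemma growth_bound_of_resolvent_bound:
  fixes S :: "real \<Rightarrow> 'a::banach \<Rightarrow>\<^sub>L 'a" and D :: "nat \<Rightarrow> real \<Rightarrow> 'a \<Rightarrow>\<^sub>L 'a"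
  assumes S: "\<And>x. continuous_on {0..} (\<lambda>t. S t x)"
    and lap: "\<And>l x. l > w \<Longrightarrow> has_laplace (\<lambda>t. S t x) l (D 0 l x)"
    and D: "\<And>n l x. l > w \<Longrightarrow> ((\<lambda>l. D n l x) has_vector_derivative D (Suc n) l x) (at l)"
    and bound: "\<And>n l. l > w \<Longrightarrow> norm (D n l) \<le> M * (Gamma (real n + \<alpha> + 1) / (l - \<omega>) powr (real n + \<alpha> + 1))"
    and "\<omega> \<le> w" "0 \<le> \<alpha>" and t: "t > 0"
  shows "norm (S t) \<le> M * (t powr \<alpha> * exp (\<omega> * t))"
proof -
  \<comment> \<open>Any \<open>b > w\<close> would do: it cancels at the end, when
    \<open>exp (- (b * t))\<close> is divided out.\<close>
  define b where "b = w + 1"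
  have b: "b > w" and d: "b - \<omega> > 0" using assms(5) by (auto simp: b_def)
  let ?u = "\<lambda>n. (n / t) ^ (n + 1) / fact n * (Gamma (n + \<alpha> + 1) / (n / t + (b - \<omega>)) powr (n + \<alpha> + 1))"
  have le: "norm (S t x) \<le> M * (t powr \<alpha> * exp (\<omega> * t)) * norm x" for x
  proof -
    let ?P = "\<lambda>j. ((- 1) ^ Suc j / fact (Suc j) * (real (Suc j) / t) ^ (j + 2)) *\<^sub>R D (Suc j) (b + real (Suc j) / t) x"
    have P: "?P \<longlonglongrightarrow> exp (- (b * t)) *\<^sub>R S t x"
      by (rule post_widder[OF S _ _ b t, where D = "\<lambda>n l. D n l x"]) (use lap D in auto)
    have bP: "norm (?P j) \<le> (M * norm x) * ?u (Suc j)" for j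
    proof -
      let ?n = "Suc j"
      have "norm (D ?n (b + real ?n / t) x) \<le> norm (D ?n (b + real ?n / t)) * norm x"
        by (rule norm_blinfun)
      also have "\<dots> \<le> (M * (Gamma (real ?n + \<alpha> + 1) / (b + real ?n / t - \<omega>) powr (real ?n + \<alpha> + 1))) * norm x"
        using b t by (intro mult_right_mono bound) (auto intro: add_pos_pos less_le_trans add_increasing2)
      finally have "(real ?n / t) ^ (j + 2) / fact ?n * norm (D ?n (b + real ?n / t) x) \<le> (real ?n / t) ^ (j + 2) / fact ?n *
          ((M * (Gamma (real ?n + \<alpha> + 1) / (b + real ?n / t - \<omega>) powr (real ?n + \<alpha> + 1))) * norm x)"
        using t by (intro mult_left_mono) auto
      moreover have "norm (?P j) = (real ?n / t) ^ (j + 2) / fact ?n * norm (D ?n (b + real ?n / t) x)"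
        using t by (simp add: abs_mult power_abs del: fact_Suc of_nat_Suc)
      moreover have "(real ?n / t) ^ (j + 2) / fact ?n *
          ((M * (Gamma (real ?n + \<alpha> + 1) / (b + real ?n / t - \<omega>) powr (real ?n + \<alpha> + 1))) * norm x) = (M * norm x) * ?u ?n"
      proof -
        have "b + real ?n / t - \<omega> = real ?n / t + (b - \<omega>)" "j + 2 = ?n + 1" by simp_all
        then show ?thesis by (simp only: mult_ac times_divide_eq_left times_divide_eq_right)
      qed
      ultimately show ?thesis by simp
    qed
    have "?u \<longlonglongrightarrow> t powr \<alpha> * exp (- ((b - \<omega>) * t))"
      by (rule widder_bound_tendsto[OF assms(6) d t])
    then have "(\<lambda>j. (M * norm x) * ?u (Suc j)) \<longlonglongrightarrow> (M * norm x) * (t powr \<alpha> * exp (- ((b - \<omega>) * t)))"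
      by (rule tendsto_mult[OF tendsto_const LIMSEQ_Suc])
    with tendsto_norm[OF P] have "norm (exp (- (b * t)) *\<^sub>R S t x) \<le> (M * norm x) * (t powr \<alpha> * exp (- ((b - \<omega>) * t)))"
      by (rule LIMSEQ_le) (use bP in blast)
    then have "exp (b * t) * (exp (- (b * t)) * norm (S t x)) \<le> exp (b * t) * ((M * norm x) * (t powr \<alpha> * exp (- ((b - \<omega>) * t))))"
      by (intro mult_left_mono) auto
    also have "\<dots> = (M * norm x) * (t powr \<alpha> * (exp (b * t) * exp (- ((b - \<omega>) * t))))" by simp
    also have "exp (b * t) * exp (- ((b - \<omega>) * t)) = exp (\<omega> * t)"
      by (simp add: algebra_simps flip: exp_add)
    also have "exp (b * t) * (exp (- (b * t)) * norm (S t x)) = norm (S t x)"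
      by (simp add: mult.assoc[symmetric] flip: exp_add)
    finally show ?thesis by (simp add: mult_ac)
  qed
  have "0 \<le> M * (t powr \<alpha> * exp (\<omega> * t)) \<or> (\<forall>x::'a. x = 0)"
  proof (rule disjCI, clarify)
    fix x :: 'a assume n: "\<not> 0 \<le> M * (t powr \<alpha> * exp (\<omega> * t))"
    have "0 \<le> M * (t powr \<alpha> * exp (\<omega> * t)) * norm x"
      using le[of x] order_trans[OF norm_ge_zero] by blast
    with n show "x = 0" by (auto simp: zero_le_mult_iff)
  qed
  \<comment> \<open>The operator-norm bound from pointwise bounds requires a nonnegative constant;
    the sign of \<open>M\<close> is read off from the bound of order 0.\<close>
  have "0 \<le> M * (Gamma (real 0 + \<alpha> + 1) / (b - \<omega>) powr (real 0 + \<alpha> + 1))"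
    using bound[OF b, of 0] norm_ge_zero order_trans by blast
  moreover have "Gamma (real 0 + \<alpha> + 1) / (b - \<omega>) powr (real 0 + \<alpha> + 1) > 0"
    using d assms(6) by (intro divide_pos_pos Gamma_real_pos) auto
  ultimately have "0 \<le> M"
    by (meson not_le mult_neg_pos)
  then show ?thesis
    using le by (intro norm_blinfun_bound) auto
qed

section \<open>Laplace transforms and resolvents under a growth bound\<close>

lemma primitive_exp_decay:
  fixes f :: "real \<Rightarrow> 'b::banach"
  assumes f: "exp_bounded f w" and l: "l > w" "l > 0"
  shows "((\<lambda>T. exp (- (l * T)) *\<^sub>R integral {0..T} f) \<longlongrightarrow> 0) at_top"
proof -
  \<comment> \<open>For negative \<open>w\<close> the primitive need not decay. A positive
    \<open>b\<close> makes \<open>exp (b * t)\<close> increasing, so that its value at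
    \<open>T\<close> bounds \<open>f\<close> on all of \<open>{0..T}\<close>.\<close>
  define b where "b = (max w 0 + l) / 2"
  have b: "b > w" "b > 0" "b < l" using l by (auto simp: b_def)
  obtain C where C: "\<And>t. t \<ge> 0 \<Longrightarrow> norm (f t) \<le> C * exp (b * t)"
    using f b unfolding exp_bounded_def by blast
  have C0: "C \<ge> 0" using C[of 0] by (simp add: order_trans[OF norm_ge_zero])
  show ?thesis
  proof (rule Lim_null_comparison)
    show "\<forall>\<^sub>F T in at_top. norm (exp (- (l * T)) *\<^sub>R integral {0..T} f) \<le> exp (- (l * T)) * (C * exp (b * T) * T)"
    proof (rule eventually_mono[OF eventually_ge_at_top[of 0]])
      fix T :: real assume T: "0 \<le> T"
      have "norm (integral {0..T} f) \<le> C * exp (b * T) * (T - 0)"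
      proof (rule integral_bound[OF T])
        show "continuous_on {0..T} f"
          using f by (auto simp: exp_bounded_def intro: continuous_on_subset)
        show "norm (f t) \<le> C * exp (b * T)" if "t \<in> {0..T}" for t
          using C[of t] that b C0 by (intro order_trans[OF C] mult_left_mono) auto
      qed
      then show "norm (exp (- (l * T)) *\<^sub>R integral {0..T} f) \<le> exp (- (l * T)) * (C * exp (b * T) * T)"
        by simp
    qed
    show "((\<lambda>T. exp (- (l * T)) * (C * exp (b * T) * T)) \<longlongrightarrow> 0) at_top"
    proof -
      define d where "d = l - b"
      have "d > 0" using b by (simp add: d_def)
      then have "((\<lambda>T. C * (T * exp (- (d * T)))) \<longlongrightarrow> 0) at_top" by real_asymp
      moreover have "exp (- (l * T)) * (C * exp (b * T) * T) = C * (T * exp (- (d * T)))" for T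
      proof -
        have "exp (- (l * T)) * exp (b * T) = exp (- (d * T))"
          by (simp add: d_def algebra_simps flip: exp_add)
        then show ?thesis by (simp add: mult_ac)
      qed
      ultimately show ?thesis by (simp only:)
    qed
  qed
qed

lemma has_laplace_powr:
  assumes "l > 0" "\<kappa> \<ge> 0"
  shows "has_laplace (\<lambda>t. t powr \<kappa> / Gamma (\<kappa> + 1)) l (1 / l powr (\<kappa> + 1))"
proof -
  have G: "Gamma (\<kappa> + 1) > 0" using assms by (intro Gamma_real_pos) auto
  have "has_improper_integral (\<lambda>t. (1 / Gamma (\<kappa> + 1)) *\<^sub>R (t powr \<kappa> * exp (- (l * t))))
      ((1 / Gamma (\<kappa> + 1)) *\<^sub>R (Gamma (\<kappa> + 1) / l powr (\<kappa> + 1)))"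
    by (intro has_improper_integral_scaleR has_improper_integral_powr_exp assms)
  then show ?thesis using G by (simp add: has_laplace_def mult_ac)
qed

lemma norm_laplace_moment_le:
  fixes f :: "real \<Rightarrow> 'b::banach"
  assumes f: "continuous_on {0..} f" and F: "has_laplace (\<lambda>t. (- t) ^ n *\<^sub>R f t) l F"
    and bound: "\<And>t. t > 0 \<Longrightarrow> norm (f t) \<le> M * (t powr \<alpha> * exp (\<omega> * t))"
    and "l > \<omega>" "\<alpha> \<ge> 0"
  shows "norm F \<le> M * (Gamma (real n + \<alpha> + 1) / (l - \<omega>) powr (real n + \<alpha> + 1))"
proof -
  let ?g = "\<lambda>t. M *\<^sub>R (t powr (real n + \<alpha>) * exp (- ((l - \<omega>) * t)))"
  have J: "has_improper_integral ?g (M *\<^sub>R (Gamma (real n + \<alpha> + 1) / (l - \<omega>) powr (real n + \<alpha> + 1)))"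
    using assms(4,5) by (intro has_improper_integral_scaleR has_improper_integral_powr_exp) auto
  have "norm F \<le> M *\<^sub>R (Gamma (real n + \<alpha> + 1) / (l - \<omega>) powr (real n + \<alpha> + 1))"
  proof (rule norm_improper_integral_le[OF F[unfolded has_laplace_def] J])
    show "continuous_on {0..} (\<lambda>t. exp (- (l * t)) *\<^sub>R (- t) ^ n *\<^sub>R f t)"
      by (intro continuous_intros f)
    show "?g integrable_on {0..T}" for T
      using assms(4,5) by (intro integrable_cmul has_improper_integral_powr_exp) auto
    show "norm (exp (- (l * t)) *\<^sub>R (- t) ^ n *\<^sub>R f t) \<le> ?g t" if t: "t > 0" for t
    proof -
      have "norm (exp (- (l * t)) *\<^sub>R (- t) ^ n *\<^sub>R f t) = exp (- (l * t)) * t ^ n * norm (f t)"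
        using t by (simp add: abs_mult power_abs)
      also have "\<dots> \<le> exp (- (l * t)) * t ^ n * (M * (t powr \<alpha> * exp (\<omega> * t)))"
        using t by (intro mult_left_mono bound) auto
      also have "\<dots> = M * ((t powr real n * t powr \<alpha>) * (exp (- (l * t)) * exp (\<omega> * t)))"
        using t by (simp add: powr_realpow mult_ac)
      also have "\<dots> = ?g t"
        by (simp add: algebra_simps flip: powr_add exp_add)
      finally show ?thesis .
    qed
  qed
  then show ?thesis by simp
qed

text \<open>The strict inequality \<open>b > \<omega>\<close> absorbs \<open>t powr \<alpha>\<close>
  at infinity. Bounded intervals, including the point 0 not covered by \<open>bound\<close>, are
  handled by continuity.\<close>

lemma exp_boundedI_powr:
  fixes f :: "real \<Rightarrow> 'b::banach"
  assumes f: "continuous_on {0..} f"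
    and bound: "\<And>t. t > 0 \<Longrightarrow> norm (f t) \<le> M * (t powr \<alpha> * exp (\<omega> * t))"
  shows "exp_bounded f \<omega>"
  unfolding exp_bounded_def
proof (intro conjI allI impI f)
  fix b :: real assume b: "b > \<omega>"
  have "((\<lambda>t. exp (- (b * t)) *\<^sub>R f t) \<longlongrightarrow> 0) at_top"
  proof (rule Lim_null_comparison)
    show "\<forall>\<^sub>F t in at_top. norm (exp (- (b * t)) *\<^sub>R f t) \<le> exp (- (b * t)) * (M * (t powr \<alpha> * exp (\<omega> * t)))"
      by (rule eventually_mono[OF eventually_gt_at_top[of 0]]) (use bound in simp)
    show "((\<lambda>t. exp (- (b * t)) * (M * (t powr \<alpha> * exp (\<omega> * t)))) \<longlongrightarrow> 0) at_top"
    proof -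
      define d where "d = b - \<omega>"
      have "d > 0" using b by (simp add: d_def)
      then have "((\<lambda>t. M * (t powr \<alpha> * exp (- (d * t)))) \<longlongrightarrow> 0) at_top" by real_asymp
      moreover have "exp (- (b * t)) * (M * (t powr \<alpha> * exp (\<omega> * t))) = M * (t powr \<alpha> * exp (- (d * t)))" for t
      proof -
        have "exp (- (b * t)) * exp (\<omega> * t) = exp (- (d * t))"
          by (simp add: d_def algebra_simps flip: exp_add)
        then show ?thesis by (simp add: mult_ac)
      qed
      ultimately show ?thesis by (simp only:)
    qed
  qed
  moreover have "continuous_on {0..} (\<lambda>t. exp (- (b * t)) *\<^sub>R f t)"
    by (intro continuous_intros f)
  ultimately obtain C where C: "\<And>t. t \<ge> 0 \<Longrightarrow> norm (exp (- (b * t)) *\<^sub>R f t) \<le> C"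
    using bounded_of_tendsto_at_top by blast
  have "norm (f t) \<le> C * exp (b * t)" if "t \<ge> 0" for t
  proof -
    have "exp (b * t) * (exp (- (b * t)) * norm (f t)) \<le> exp (b * t) * C"
      using C[OF that] by (intro mult_left_mono) auto
    then show ?thesis by (simp add: mult_ac mult.assoc[symmetric] flip: exp_add)
  qed
  then show "\<exists>C. \<forall>t\<ge>0. norm (f t) \<le> C * exp (b * t)" by blast
qed

text \<open>The orbitwise transforms are assembled into an operator: linearity comes from uniqueness
  of transforms, boundedness from the Gamma integral for \<open>n = 0\<close>.\<close>

lemma laplace_operator_exists:
  fixes S :: "real \<Rightarrow> 'a::banach \<Rightarrow>\<^sub>L 'a"
  assumes S: "\<And>x. continuous_on {0..} (\<lambda>t. S t x)"
    and bound: "\<And>t. t > 0 \<Longrightarrow> norm (S t) \<le> M * (t powr \<alpha> * exp (\<omega> * t))"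
    and "l > \<omega>" "\<alpha> \<ge> 0"
  shows "\<exists>L. has_laplace_transform S l L"
proof -
  have bound': "norm (S t x) \<le> M * norm x * (t powr \<alpha> * exp (\<omega> * t))" if "t > 0" for t x
  proof -
    have "norm (S t x) \<le> norm (S t) * norm x" by (rule norm_blinfun)
    also have "\<dots> \<le> M * (t powr \<alpha> * exp (\<omega> * t)) * norm x"
      using that by (intro mult_right_mono bound) auto
    finally show ?thesis by (simp add: mult_ac)
  qed
  let ?L = "\<lambda>x. laplace (\<lambda>t. S t x) l"
  have L: "has_laplace (\<lambda>t. S t x) l (?L x)" for x
    by (rule has_laplace_laplace[OF exp_boundedI_powr[OF S bound'] assms(3)])
  have "bounded_linear ?L"
  proof (rule bounded_linear_intro)
    show "?L (x + y) = ?L x + ?L y" for x y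
      using has_laplace_add[OF L[of x] L[of y] S S] by (intro laplace_eqI) (simp add: blinfun.bilinear_simps)
    show "?L (r *\<^sub>R x) = r *\<^sub>R ?L x" for r x
      using has_laplace_scaleR[OF L[of x], of r] by (intro laplace_eqI) (simp add: blinfun.bilinear_simps)
    show "norm (?L x) \<le> norm x * (M * (Gamma (real 0 + \<alpha> + 1) / (l - \<omega>) powr (real 0 + \<alpha> + 1)))" for x
      using norm_laplace_moment_le[OF S _ bound' assms(3,4), of 0 x "?L x"] L[of x] by (simp add: mult_ac)
  qed
  then have "blinfun_apply (Blinfun ?L) = ?L" by (rule bounded_linear_Blinfun_apply)
  with L show ?thesis unfolding has_laplace_transform_iff by metis
qed

lemma resolvent_of_growth_bound:
  fixes S :: "real \<Rightarrow> 'a::banach \<Rightarrow>\<^sub>L 'a"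
  assumes gen: "integrated_semigroup_generator \<kappa> S A"
    and bound: "\<And>t. t > 0 \<Longrightarrow> norm (S t) \<le> M * (t powr \<alpha> * exp (\<omega> * t))"
    and "0 \<le> \<kappa>" "0 \<le> \<alpha>" "0 \<le> a" "\<omega> \<le> a" "l > a"
  shows "l \<in> resolvent_set A" "has_laplace_transform S l ((1 / l powr \<kappa>) *\<^sub>R resolvent l A)"
proof -
  have S: "continuous_on {0..} (\<lambda>t. S t x)" for x
    using gen by (auto simp: integrated_semigroup_generator_def)
  obtain \<omega>\<^sub>0 where w0: "{\<omega>\<^sub>0<..} \<subseteq> resolvent_set A"
    "\<And>l. l > \<omega>\<^sub>0 \<Longrightarrow> \<exists>L. has_laplace_transform S l L \<and> resolvent l A = (l powr \<kappa>) *\<^sub>R L"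
    using gen by (auto simp: integrated_semigroup_generator_def)
  have "\<exists>L. \<forall>l>\<omega>. has_laplace_transform S l (L l)"
    using laplace_operator_exists[OF S bound _ assms(4)] by metis
  then obtain L where "\<And>l. l > \<omega> \<Longrightarrow> has_laplace_transform S l (L l)" by blast
  then have L: "has_laplace (\<lambda>t. S t x) l (L l x)" if "l > a" for l x
    using that assms(6) by (simp add: has_laplace_transform_iff)
  \<comment> \<open>The integrals converge for all \<open>l > a\<close>, but only beyond
    \<open>\<omega>\<^sub>0\<close>, which may exceed \<open>a\<close>, are they known to give the
    resolvent.\<close>
  define w where "w = max a \<omega>\<^sub>0"
  define Q where "Q l = (l powr \<kappa>) *\<^sub>R L l" for l
  have res: "resolvent l A = Q l" "l \<in> resolvent_set A" if l: "l > w" for l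
  proof -
    have l': "l > a" "l > \<omega>\<^sub>0" using l by (auto simp: w_def)
    obtain L' where L': "has_laplace_transform S l L'" "resolvent l A = (l powr \<kappa>) *\<^sub>R L'"
      using w0(2)[OF l'(2)] by blast
    have "L' = L l"
      using L'(1) L[OF l'(1)] by (intro blinfun_eqI) (auto simp: has_laplace_transform_iff intro: has_laplace_unique)
    then show "resolvent l A = Q l" using L'(2) by (simp add: Q_def)
    show "l \<in> resolvent_set A" using w0(1) l'(2) by auto
  qed
  define c where "c = w + 1"
  define R where "R = resolvent c A"
  have c: "c > w" "c \<in> resolvent_set A" using res(2)[of c] by (auto simp: c_def)
  have cR: "continuous_on {0..} (\<lambda>t. R (S t x))" for x
    by (intro continuous_intros S)
  have commQ: "Q l (R x) = R (Q l x)" if "l > w" for l x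
    unfolding R_def res(1)[OF that, symmetric] by (rule resolvent_commute[OF res(2)[OF that] c(2)])
  \<comment> \<open>Commutation is carried from the resolvents at large \<open>l\<close> to
    \<open>S\<close> itself by injectivity, and from \<open>S\<close> back to the transforms at
    every \<open>l > a\<close>.\<close>
  have commS: "R (S t x) = S t (R x)" if t: "t > 0" for t x
  proof -
    have "R (S t x) - S t (R x) = 0"
    proof (rule laplace_injective[OF _ _ t, where w = w])
      show "continuous_on {0..} (\<lambda>t. R (S t x) - S t (R x))"
        by (intro continuous_intros cR S)
      fix l assume l: "l > w"
      then have la: "l > a" "l > 0" using assms(5) by (auto simp: w_def)
      have "has_laplace (\<lambda>t. R (S t x) - S t (R x)) l (R (L l x) - L l (R x))"
        by (intro has_laplace_diff has_laplace_linear[OF L S blinfun.bounded_linear_right] L cR S la)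
      moreover have "(l powr \<kappa>) *\<^sub>R R (L l x) = (l powr \<kappa>) *\<^sub>R L l (R x)"
        using commQ[OF l, of x, symmetric] by (simp add: Q_def blinfun.bilinear_simps)
      ultimately show "has_laplace (\<lambda>t. R (S t x) - S t (R x)) l 0"
        using la by simp
    qed
    then show ?thesis by simp
  qed
  have commL: "L l (R x) = R (L l x)" if "l > a" for l x
  proof (rule has_laplace_unique)
    show "has_laplace (\<lambda>t. S t (R x)) l (L l (R x))" by (rule L[OF that])
    have "has_laplace (\<lambda>t. R (S t x)) l (R (L l x))"
      by (rule has_laplace_linear[OF L[OF that] S blinfun.bounded_linear_right])
    then show "has_laplace (\<lambda>t. S t (R x)) l (R (L l x))"
      by (simp add: has_laplace_cong[of "\<lambda>t. R (S t x)" "\<lambda>t. S t (R x)"] commS)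
  qed
  \<comment> \<open>For \<open>l > w\<close> this is the resolvent identity. It spreads to
    \<open>l > a\<close> because both ranges see the same function on the half-line, independent of
    \<open>l\<close>.\<close>
  have ident: "Q l x - R x = (c - l) *\<^sub>R R (Q l x)" if l: "l > a" for l x
  proof -
    define V where "V t = integral {0..t} (\<lambda>s. S s x)" for t
    \<comment> \<open>The case distinction makes \<open>q\<close> continuous at 0, as \<open>0 powr 0 = 0\<close>.\<close>
    define q where "q t = (if \<kappa> = 0 then 1 else t powr \<kappa>) / Gamma (\<kappa> + 1)" for t
    \<comment> \<open>The Laplace transform of \<open>h\<close> is \<open>l\<close> to the power \<open>- \<kappa> - 1\<close> times the difference of the two sides.\<close>
    define h where "h t = V t - q t *\<^sub>R R x - c *\<^sub>R R (V t) + R (S t x)" for t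
    define E where "E l = (1 / l) *\<^sub>R L l x - (1 / l powr (\<kappa> + 1)) *\<^sub>R R x - c *\<^sub>R R ((1 / l) *\<^sub>R L l x) + R (L l x)" for l
    have cV: "continuous_on {0..} V"
      unfolding V_def by (rule continuous_on_primitive[OF S])
    have cq: "continuous_on {0..} q"
    proof (cases "\<kappa> = 0")
      case False
      then have "continuous_on {0..} (\<lambda>t. t powr \<kappa>)"
        using assms(3) by (intro continuous_on_powr' continuous_intros) auto
      moreover have "Gamma (\<kappa> + 1) \<noteq> 0"
        using Gamma_real_pos[of "\<kappa> + 1"] assms(3) by linarith
      ultimately show ?thesis
        unfolding q_def using False by (auto intro!: continuous_intros)
    qed (simp add: q_def)
    have ch: "continuous_on {0..} h"
      unfolding h_def by (intro continuous_intros cV cq cR)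
    have hE: "has_laplace h l (E l)" if l: "l > a" for l
    proof -
      have l0: "l > 0" using l assms(5) by simp
      have expS: "exp_bounded (\<lambda>t. S t x) \<omega>"
      proof (rule exp_boundedI_powr[OF S])
        fix t :: real assume "t > 0"
        have "norm (S t x) \<le> norm (S t) * norm x" by (rule norm_blinfun)
        also have "\<dots> \<le> M * (t powr \<alpha> * exp (\<omega> * t)) * norm x"
          using \<open>t > 0\<close> by (intro mult_right_mono bound) auto
        finally show "norm (S t x) \<le> M * norm x * (t powr \<alpha> * exp (\<omega> * t))" by (simp add: mult_ac)
      qed
      have V: "has_laplace V l ((1 / l) *\<^sub>R L l x)"
        unfolding V_def[abs_def] using l l0 assms(6)
        by (intro has_laplace_primitive[OF S L] primitive_exp_decay[OF expS]) auto
      have "has_laplace q l (1 / l powr (\<kappa> + 1))"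
        using has_laplace_powr[OF l0 assms(3)]
        by (subst has_laplace_cong[where g = "\<lambda>t. t powr \<kappa> / Gamma (\<kappa> + 1)"]) (auto simp: q_def)
      then have q: "has_laplace (\<lambda>t. q t *\<^sub>R R x) l ((1 / l powr (\<kappa> + 1)) *\<^sub>R R x)"
        by (rule has_laplace_linear[OF _ cq bounded_linear_scaleR_left])
      have RV: "has_laplace (\<lambda>t. c *\<^sub>R R (V t)) l (c *\<^sub>R R ((1 / l) *\<^sub>R L l x))"
        by (intro has_laplace_scaleR has_laplace_linear[OF V cV blinfun.bounded_linear_right])
      have RS: "has_laplace (\<lambda>t. R (S t x)) l (R (L l x))"
        by (rule has_laplace_linear[OF L[OF l] S blinfun.bounded_linear_right])
      show ?thesis
        unfolding h_def[abs_def] E_def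
        by (intro has_laplace_add has_laplace_diff V q RV RS continuous_intros cV cq cR)
    qed
    have EQ: "(l powr (\<kappa> + 1)) *\<^sub>R E l = Q l x - R x - (c - l) *\<^sub>R R (Q l x)" if "l > a" for l
    proof -
      have "l > 0" using that assms(5) by simp
      then show ?thesis
        by (simp add: E_def Q_def blinfun.bilinear_simps powr_add algebra_simps)
    qed
    have h0: "h t = 0" if t: "t > 0" for t
    proof (rule laplace_injective[OF ch _ t, where w = w])
      fix l assume lw: "l > w"
      then have la: "l > a" "l > 0" using assms(5) by (auto simp: w_def)
      have "Q l x - R x = (c - l) *\<^sub>R Q l (R x)"
        using resolvent_identity[OF res(2)[OF lw] c(2), of x] by (simp add: res(1)[OF lw] R_def)
      then have "(l powr (\<kappa> + 1)) *\<^sub>R E l = 0"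
        unfolding EQ[OF la(1)] commQ[OF lw] by simp
      then have "E l = 0" using la by simp
      with hE[OF la(1)] show "has_laplace h l 0" by simp
    qed
    have "has_laplace (\<lambda>t. 0) l (E l)"
      using hE[OF l] has_laplace_cong[of h "\<lambda>t. 0" l] h0 by simp
    moreover have "has_laplace (\<lambda>t. 0 :: 'a) l 0"
      by (simp add: has_laplace_def has_improper_integral_def)
    ultimately have "E l = 0" by (rule has_laplace_unique)
    with EQ[OF l] show ?thesis by simp
  qed
  have "shifted_inverse l A = op_graph (Q l)"
  proof (rule pseudo_resolvent_shifted_inverse[OF c(2), folded R_def])
    show "Q l x - R x = (c - l) *\<^sub>R R (Q l x)" for x
      by (rule ident[OF assms(7)])
    show "Q l (R x) = R (Q l x)" for x
      using commL[OF assms(7), of x] by (simp add: Q_def blinfun.bilinear_simps)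
  qed
  from resolvent_eqI[OF this] show "l \<in> resolvent_set A"
    "has_laplace_transform S l ((1 / l powr \<kappa>) *\<^sub>R resolvent l A)"
    using L[OF assms(7)] assms(5,7) by (simp_all add: Q_def has_laplace_transform_iff)
qed

text \<open>At a vector \<open>x\<close>, the operator-norm derivatives and the moments of the orbit
  are two derivative chains with the same start, so the Gamma integral estimate for moments applies.
  It is linear in \<open>norm x\<close>, which returns an operator-norm bound.\<close>

lemma norm_nth_vector_derivative_le:
  fixes S :: "real \<Rightarrow> 'a::banach \<Rightarrow>\<^sub>L 'a"
  assumes S: "\<And>x. continuous_on {0..} (\<lambda>t. S t x)"
    and bound: "\<And>t. t > 0 \<Longrightarrow> norm (S t) \<le> M * (t powr \<alpha> * exp (\<omega> * t))"
    and res: "{a<..} \<subseteq> resolvent_set A"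
    and lap: "\<And>l. l > a \<Longrightarrow> has_laplace_transform S l ((1 / l powr \<kappa>) *\<^sub>R resolvent l A)"
    and "0 \<le> \<alpha>" "0 \<le> a" "\<omega> \<le> a" "l > a"
  shows "norm (nth_vector_derivative n (\<lambda>l. (1 / l powr \<kappa>) *\<^sub>R resolvent l A) l)
    \<le> M * (Gamma (real n + \<alpha> + 1) / (l - \<omega>) powr (real n + \<alpha> + 1))"
proof (rule norm_blinfun_bound)
  define F where "F = (\<lambda>l. (1 / l powr \<kappa>) *\<^sub>R resolvent l A)"
  \<comment> \<open>The growth bound at \<open>t = 1\<close> shows that \<open>M\<close> is
    nonnegative.\<close>
  have "0 \<le> M * (1 powr \<alpha> * exp (\<omega> * 1))"
    using bound[of 1] norm_ge_zero order_trans zero_less_one by blast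
  then have "0 \<le> M" by (simp add: zero_le_mult_iff)
  then show "0 \<le> M * (Gamma (real n + \<alpha> + 1) / (l - \<omega>) powr (real n + \<alpha> + 1))"
    using assms(5) by (intro mult_nonneg_nonneg divide_nonneg_nonneg less_imp_le[OF Gamma_real_pos]) auto
  fix x
  have bound': "norm (S t x) \<le> M * norm x * (t powr \<alpha> * exp (\<omega> * t))" if "t > 0" for t
  proof -
    have "norm (S t x) \<le> norm (S t) * norm x" by (rule norm_blinfun)
    also have "\<dots> \<le> M * (t powr \<alpha> * exp (\<omega> * t)) * norm x"
      using that by (intro mult_right_mono bound) auto
    finally show ?thesis by (simp add: mult_ac)
  qed
  have expS: "exp_bounded (\<lambda>t. S t x) \<omega>"
    by (rule exp_boundedI_powr[OF S bound'])
  have "nth_vector_derivative n F l x = laplace (\<lambda>t. (- t) ^ n *\<^sub>R S t x) l"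
  proof (rule derivative_chain_unique[where w = a and D = "\<lambda>n l. nth_vector_derivative n F l x"
        and E = "\<lambda>n l. laplace (\<lambda>t. (- t) ^ n *\<^sub>R S t x) l", OF _ _ _ assms(8)])
    show "((\<lambda>l. nth_vector_derivative n F l x) has_vector_derivative nth_vector_derivative (Suc n) F l x) (at l)"
      if "l > a" for n l
      unfolding F_def by (rule nth_vector_derivative_scaled_resolvent[OF assms(6) res that])
    show "((\<lambda>l. laplace (\<lambda>t. (- t) ^ n *\<^sub>R S t x) l) has_vector_derivative
        laplace (\<lambda>t. (- t) ^ Suc n *\<^sub>R S t x) l) (at l)" if "l > a" for n l
      using that assms(7) by (intro laplace_moment_has_vector_derivative[OF expS]) auto
    show "nth_vector_derivative 0 F l x = laplace (\<lambda>t. (- t) ^ 0 *\<^sub>R S t x) l" if "l > a" for l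
      using lap[OF that] by (auto simp: has_laplace_transform_iff nth_vector_derivative_def F_def intro!: laplace_eqI[symmetric])
  qed
  moreover have "has_laplace (\<lambda>t. (- t) ^ n *\<^sub>R S t x) l (laplace (\<lambda>t. (- t) ^ n *\<^sub>R S t x) l)"
    using assms(7,8) by (intro has_laplace_laplace[OF exp_bounded_moment[OF expS]]) auto
  ultimately have "norm (nth_vector_derivative n F l x)
      \<le> M * norm x * (Gamma (real n + \<alpha> + 1) / (l - \<omega>) powr (real n + \<alpha> + 1))"
    using norm_laplace_moment_le[OF S _ bound' _ assms(5)] assms(7,8) by simp
  then show "norm (nth_vector_derivative n (\<lambda>l. (1 / l powr \<kappa>) *\<^sub>R resolvent l A) l x)
      \<le> M * (Gamma (real n + \<alpha> + 1) / (l - \<omega>) powr (real n + \<alpha> + 1)) * norm x"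
    by (simp add: F_def mult_ac)
qed

theorem theorem2p6:
  fixes S :: "real \<Rightarrow> 'a::banach \<Rightarrow>\<^sub>L 'a"
    and A :: "('a \<times> 'a) set"
    and \<kappa> a \<omega> \<alpha> :: real
  assumes "0 \<le> \<kappa>"
    and "integrated_semigroup_generator \<kappa> S A"
    and "0 \<le> a" and "\<omega> \<le> a" and "0 \<le> \<alpha>" and "\<alpha> \<le> \<kappa>"
  shows "bdd_above ((\<lambda>t. t powr (- \<alpha>) * exp (- (\<omega> * t)) * norm (S t)) ` {0<..})
    \<longleftrightarrow>
    {a<..} \<subseteq> resolvent_set A \<and>
    bdd_above ((\<lambda>(n, l).
        norm (((l - \<omega>) powr (real n + \<alpha> + 1) / Gamma (real n + \<alpha> + 1)) *\<^sub>R
              nth_vector_derivative n (\<lambda>\<mu>. (1 / \<mu> powr \<kappa>) *\<^sub>R resolvent \<mu> A) l))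
      ` (UNIV \<times> {a<..}))"
proof -
  let ?F = "\<lambda>\<mu>. (1 / \<mu> powr \<kappa>) *\<^sub>R resolvent \<mu> A"
  let ?c = "\<lambda>n l. (l - \<omega>) powr (real n + \<alpha> + 1) / Gamma (real n + \<alpha> + 1)"
  have S: "continuous_on {0..} (\<lambda>t. S t x)" for x
    using assms(2) by (auto simp: integrated_semigroup_generator_def)
  have c: "?c n l > 0" if "l > a" for n l
    using that assms(4,5) by (intro divide_pos_pos Gamma_real_pos) auto
  have norm_c: "norm (?c n l *\<^sub>R nth_vector_derivative n ?F l) \<le> M \<longleftrightarrow>
      norm (nth_vector_derivative n ?F l) \<le> M * (Gamma (real n + \<alpha> + 1) / (l - \<omega>) powr (real n + \<alpha> + 1))"
    if "l > a" for n l M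
  proof -
    have "norm (?c n l *\<^sub>R nth_vector_derivative n ?F l) = norm (nth_vector_derivative n ?F l) * ?c n l"
      using c[OF that, of n] by (simp only: norm_scaleR abs_of_pos mult.commute)
    moreover have "M * (Gamma (real n + \<alpha> + 1) / (l - \<omega>) powr (real n + \<alpha> + 1)) = M / ?c n l"
      by simp
    ultimately show ?thesis
      using pos_le_divide_eq[OF c[OF that, of n]] by simp
  qed
  have growth: "t powr (- \<alpha>) * exp (- (\<omega> * t)) * norm (S t) \<le> M \<longleftrightarrow> norm (S t) \<le> M * (t powr \<alpha> * exp (\<omega> * t))"
    if "t > 0" for t M
  proof -
    have "t powr (- \<alpha>) * exp (- (\<omega> * t)) * norm (S t) = norm (S t) / (t powr \<alpha> * exp (\<omega> * t))"
      by (simp add: powr_minus exp_minus field_simps)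
    then show ?thesis
      using that by (simp add: pos_divide_le_eq)
  qed
  show ?thesis
  proof (intro iffI conjI)
    assume "bdd_above ((\<lambda>t. t powr (- \<alpha>) * exp (- (\<omega> * t)) * norm (S t)) ` {0<..})"
    then obtain M where "\<And>t. t > 0 \<Longrightarrow> t powr (- \<alpha>) * exp (- (\<omega> * t)) * norm (S t) \<le> M"
      unfolding bdd_above_def by auto
    then have M: "norm (S t) \<le> M * (t powr \<alpha> * exp (\<omega> * t))" if "t > 0" for t
      using growth[OF that] that by blast
    note R = resolvent_of_growth_bound[OF assms(2) M assms(1,5,3,4)]
    show res: "{a<..} \<subseteq> resolvent_set A"
      using R(1) by auto
    have "norm (?c n l *\<^sub>R nth_vector_derivative n ?F l) \<le> M" if "l > a" for n l
      unfolding norm_c[OF that]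
      by (rule norm_nth_vector_derivative_le[OF S M res R(2) assms(5,3,4) that])
    then show "bdd_above ((\<lambda>(n, l). norm (?c n l *\<^sub>R nth_vector_derivative n ?F l)) ` (UNIV \<times> {a<..}))"
      by (intro bdd_aboveI[of _ M]) auto
  next
    assume 2: "{a<..} \<subseteq> resolvent_set A \<and>
      bdd_above ((\<lambda>(n, l). norm (?c n l *\<^sub>R nth_vector_derivative n ?F l)) ` (UNIV \<times> {a<..}))"
    then obtain M where "\<And>n l. l > a \<Longrightarrow> norm (?c n l *\<^sub>R nth_vector_derivative n ?F l) \<le> M"
      unfolding bdd_above_def by force
    then have M: "norm (nth_vector_derivative n ?F l) \<le> M * (Gamma (real n + \<alpha> + 1) / (l - \<omega>) powr (real n + \<alpha> + 1))"
      if "l > a" for n l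
      using norm_c[OF that] that by blast
    obtain \<omega>\<^sub>0 where w0: "\<And>l. l > \<omega>\<^sub>0 \<Longrightarrow> \<exists>L. has_laplace_transform S l L \<and> resolvent l A = (l powr \<kappa>) *\<^sub>R L"
      using assms(2) by (auto simp: integrated_semigroup_generator_def)
    \<comment> \<open>The derivative bounds hold beyond \<open>a\<close>, the Laplace representation
      beyond \<open>\<omega>\<^sub>0\<close>. The inversion formula only evaluates at large
      \<open>l\<close>, so their common range is enough to recover \<open>S\<close>.\<close>
    define w where "w = max a \<omega>\<^sub>0"
    have w: "w \<ge> 0" "{w<..} \<subseteq> resolvent_set A" "\<omega> \<le> w"
      using 2 assms(3,4) by (auto simp: w_def)
    have lap: "has_laplace (\<lambda>t. S t x) l (nth_vector_derivative 0 ?F l x)" if l: "l > w" for l x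
    proof -
      obtain L where L: "has_laplace_transform S l L" "resolvent l A = (l powr \<kappa>) *\<^sub>R L"
        using w0[of l] l by (auto simp: w_def)
      have "nth_vector_derivative 0 ?F l = L"
        using l w(1) by (simp add: nth_vector_derivative_def L(2))
      with L(1) show ?thesis by (simp add: has_laplace_transform_iff)
    qed
    have "norm (S t) \<le> M * (t powr \<alpha> * exp (\<omega> * t))" if "t > 0" for t
    proof (rule growth_bound_of_resolvent_bound[where D = "\<lambda>n. nth_vector_derivative n ?F", OF S lap _ _ w(3) assms(5) that])
      show "((\<lambda>l. nth_vector_derivative n ?F l x) has_vector_derivative nth_vector_derivative (Suc n) ?F l x) (at l)"
        if "l > w" for n l x
        by (rule nth_vector_derivative_scaled_resolvent[OF w(1,2) that])
      show "norm (nth_vector_derivative n ?F l) \<le> M * (Gamma (real n + \<alpha> + 1) / (l - \<omega>) powr (real n + \<alpha> + 1))"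
        if "l > w" for n l
        using that by (intro M) (simp add: w_def)
    qed
    then show "bdd_above ((\<lambda>t. t powr (- \<alpha>) * exp (- (\<omega> * t)) * norm (S t)) ` {0<..})"
      by (intro bdd_aboveI[of _ M]) (auto simp: growth)
  qed
qed

end
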